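(* For any $0<\varepsilon<1$ and every $n$ there is a deterministic $n^{O(1)}$-time algorithm (the exponent being a constant independent of $\varepsilon$ and $n$) for computing a $c$-long-distance $\varepsilon$-synchronization string of length $n$, with $c=O(1/\varepsilon)$, over an alphabet of size $O(\varepsilon^{-4})$.
   Context: The edit distance $ED(a,b)$ of two strings is the minimum number of insertions and deletions of single symbols needed to transform $a$ into $b$. $S[i,j)$ denotes the substring of $S$ from position $i$ up to but not including position $j$. For a function $f$, a string $S\in\Sigma^n$ is an $f(l)$-distance $\varepsilon$-synchronization string if for every $1\le i<j\le i'<j'\le n+1$, writing $l=(j-i)+(j'-i')$, whenever $i'-j\le f(l)$ one has $ED(S[i,j),S[i',j'))>(1-\varepsilon)l$. A $c$-long-distance $\varepsilon$-synchronization string of length $n$ is an $f(l)$-distance $\varepsilon$-synchronization string for $f(l)=n\cdot\mathbf 1_{l>c\log n}$; that is, the inequality is required for all adjacent pairs of intervals ($i'=j$), and for all pairs of disjoint intervals of total length $l>c\log n$ at arbitrary distance. Multiplicative constants in the running time may depend on $\varepsilon$. *)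

theory Defs
  imports Complex_Main "HOL-Library.Landau_Symbols"
begin

section \<open>Edit distance\<close>

definition edit_step :: "'a list \<Rightarrow> 'a list \<Rightarrow> bool" where
  "edit_step a b \<longleftrightarrow>
     (\<exists>u x v. a = u @ v \<and> b = u @ x # v \<or> a = u @ x # v \<and> b = u @ v)"

definition ED :: "'a list \<Rightarrow> 'a list \<Rightarrow> nat" where
  "ED a b = (LEAST k. (edit_step ^^ k) a b)"

text \<open>Any two strings are connected by edit steps, so the minimum is attained.\<close>

lemma relpowp_edit_step_ED: "(edit_step ^^ ED a b) a b"
proof -
  have del: "(edit_step ^^ length a) a []" for a :: "'a list"
  proof (induction a)
    case (Cons x a)
    have "edit_step (x # a) a"
      unfolding edit_step_def by (metis append_Nil)
    then show ?case using relpowp_Suc_I2 Cons by (metis length_Cons)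
  qed simp
  have ins: "(edit_step ^^ length b) [] b" for b :: "'a list"
  proof (induction b)
    case (Cons x b)
    have "edit_step b (x # b)"
      unfolding edit_step_def by (metis append_Nil)
    then show ?case using relpowp_Suc_I Cons by (metis length_Cons)
  qed simp
  have "(edit_step ^^ (length a + length b)) a b"
    using del[of a] ins[of b] by (auto simp: relpowp_add)
  then show ?thesis unfolding ED_def by (rule LeastI)
qed


section \<open>Synchronization strings\<close>

text \<open>\<open>substr S i j\<close> is the substring $S[i,j)$, where positions are counted from 1.\<close>

definition substr :: "'a list \<Rightarrow> nat \<Rightarrow> nat \<Rightarrow> 'a list" where
  "substr S i j = take (j - i) (drop (i - 1) S)"

definition distance_sync_string :: "(nat \<Rightarrow> real) \<Rightarrow> real \<Rightarrow> 'a list \<Rightarrow> bool" where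
  "distance_sync_string f \<epsilon> S \<longleftrightarrow>
     (\<forall>i j i' j'. 1 \<le> i \<and> i < j \<and> j \<le> i' \<and> i' < j' \<and> j' \<le> length S + 1 \<longrightarrow>
        (let l = (j - i) + (j' - i') in
           real (i' - j) \<le> f l \<longrightarrow>
           real (ED (substr S i j) (substr S i' j')) > (1 - \<epsilon>) * real l))"

definition long_distance_sync_string :: "real \<Rightarrow> real \<Rightarrow> 'a list \<Rightarrow> bool" where
  "long_distance_sync_string c \<epsilon> S \<longleftrightarrow>
     (let n = length S in
        distance_sync_string
          (\<lambda>l. real n * of_bool (real l > c * log 2 (real n))) \<epsilon> S)"


section \<open>Deterministic algorithms and their running time\<close>

text \<open>
  Algorithms are structured programs for a random access machine. The memory is divided
  into banks of cells holding natural numbers; \<open>s a i\<close> is the content of cell \<open>i\<close> of bank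
  \<open>a\<close>. Cell indices are computed at run time, whereas bank numbers are literals in the
  program text, so that a program uses only finitely many banks.

  The arithmetic operations are addition and truncated subtraction. There is no
  multiplication: in \<open>t\<close> unit-cost steps only numbers of \<open>O(t)\<close> bits can arise, hence the
  running time is, up to a polynomial, that of a multitape Turing machine.
\<close>

type_synonym state = "nat \<Rightarrow> nat \<Rightarrow> nat"

datatype expr =
    Const nat
  | Read nat expr
  | Add expr expr
  | Sub expr expr

fun eval_expr :: "expr \<Rightarrow> state \<Rightarrow> nat" where
  "eval_expr (Const k) s = k"
| "eval_expr (Read a e) s = s a (eval_expr e s)"
| "eval_expr (Add e e') s = eval_expr e s + eval_expr e' s"
| "eval_expr (Sub e e') s = eval_expr e s - eval_expr e' s"

fun cost_expr :: "expr \<Rightarrow> nat" where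
  "cost_expr (Const k) = 1"
| "cost_expr (Read a e) = cost_expr e + 1"
| "cost_expr (Add e e') = cost_expr e + cost_expr e' + 1"
| "cost_expr (Sub e e') = cost_expr e + cost_expr e' + 1"

text \<open>As a condition, an expression counts as true if its value is nonzero.\<close>

datatype program =
    Skip
  | Write nat expr expr
  | Seq program program
  | Cond expr program program
  | While expr program

text \<open>\<open>runs p s t s'\<close>: started in state \<open>s\<close>, program \<open>p\<close> halts after \<open>t\<close> steps in state \<open>s'\<close>.\<close>

inductive runs :: "program \<Rightarrow> state \<Rightarrow> nat \<Rightarrow> state \<Rightarrow> bool" where
  Skip: "runs Skip s 1 s"
| Write: "runs (Write a e e') s (cost_expr e + cost_expr e' + 1)
            (s(a := (s a)(eval_expr e s := eval_expr e' s)))"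
| Seq: "runs p s t s' \<Longrightarrow> runs p' s' t' s'' \<Longrightarrow> runs (Seq p p') s (t + t') s''"
| Cond_true: "eval_expr e s \<noteq> 0 \<Longrightarrow> runs p s t s' \<Longrightarrow>
                runs (Cond e p p') s (cost_expr e + 1 + t) s'"
| Cond_false: "eval_expr e s = 0 \<Longrightarrow> runs p' s t s' \<Longrightarrow>
                runs (Cond e p p') s (cost_expr e + 1 + t) s'"
| While_false: "eval_expr e s = 0 \<Longrightarrow> runs (While e p) s (cost_expr e + 1) s"
| While_true: "eval_expr e s \<noteq> 0 \<Longrightarrow> runs p s t s' \<Longrightarrow> runs (While e p) s' t' s'' \<Longrightarrow>
                runs (While e p) s (cost_expr e + 1 + t + t') s''"

inductive_cases runs_elims:
  "runs Skip s t s'"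
  "runs (Write a e e') s t s'"
  "runs (Seq p p') s t s'"
  "runs (Cond e p p') s t s'"
  "runs (While e p) s t s'"

lemma runs_deterministic:
  "runs p s t s' \<Longrightarrow> runs p s u r \<Longrightarrow> u = t \<and> r = s'"
proof (induction arbitrary: u r rule: runs.induct)
  case (Skip s)
  then show ?case by (rule runs_elims(1)) simp
next
  case (Write a e e' s)
  then show ?case by (rule runs_elims(2)) simp
next
  case (Seq p s t s' p' t' s'')
  from Seq.prems show ?case by (rule runs_elims(3)) (use Seq.IH in blast)
next
  case (Cond_true e s p t s' p')
  from Cond_true.prems show ?case
    by (rule runs_elims(4)) (use Cond_true.hyps in \<open>auto dest: Cond_true.IH\<close>)
next
  case (Cond_false e s p' t s' p)
  from Cond_false.prems show ?case
    by (rule runs_elims(4)) (use Cond_false.hyps in \<open>auto dest: Cond_false.IH\<close>)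
next
  case (While_false e s p)
  from While_false.prems show ?case
    by (rule runs_elims(5)) (use While_false.hyps in auto)
next
  case (While_true e s p t s' t' s'')
  from While_true.prems show ?case
  proof (cases rule: runs_elims(5)[consumes 1, case_names stop loop])
    case stop
    with While_true.hyps show ?thesis by simp
  next
    case (loop t1 s1 t2)
    have "t1 = t" "s1 = s'"
      using While_true.IH(1)[OF loop(3)] by simp_all
    with While_true.IH(2)[of t2 r] loop show ?thesis by simp
  qed
qed

text \<open>
  The input \<open>n\<close> is in cell 0 of bank 0, all other cells being 0 initially; the output, a
  string of \<open>n\<close> symbols, is in the first \<open>n\<close> cells of bank 1 when the program halts.
\<close>

definition initial_state :: "nat \<Rightarrow> state" where
  "initial_state n = (\<lambda>a i. if a = 0 \<and> i = 0 then n else 0)"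

definition computes_string :: "program \<Rightarrow> nat \<Rightarrow> nat \<Rightarrow> nat list \<Rightarrow> bool" where
  "computes_string p n t S \<longleftrightarrow>
     (\<exists>s. runs p (initial_state n) t s \<and> S = map (s 1) [0..<n])"

end

(*
  Symbols are chosen greedily, guided by a potential that counts, with exponentially
  decaying weights, the common subsequences of pairs of windows. A common subsequence whose
  first matched positions are i < b has weight 4 per matched pair after the first and loses a factor
  mu = m/D, D = m + 2, for every further position that either window extends over; windows
  at distance d are weighted by theta^d + 1/n with theta = (m + 1)/D > mu. Averaged over the
  8 D^2 choices of the next symbol, the potential contracts by the factor theta up to a bounded
  contribution of the newly started windows, so some symbol keeps it below 1/4.
  A common subsequence of length r >= 1 in adjacent windows of total length l
  then satisfies 4^r <= (D/m)^l, and in windows at arbitrary distance 4^r <= n (D/m)^l. With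
  m of order 8/epsilon this gives r < epsilon l / 2 in both cases, hence the claim with
  c = 2/epsilon. The potential obeys a linear recurrence in integers scaled by powers of D, so
  it is computable in polynomial time with additions only.
*)
theory Submission
  imports Defs "HOL-Library.Sublist"
begin

section \<open>Edit distance and common subsequences\<close>

text \<open>Induction on the steps: an insertion keeps the common subsequence \<open>c\<close>, and
  a deletion destroys at most one of its symbols, so \<open>length b - 2 * length c\<close> grows by
  at most one per step.\<close>

lemma relpowp_edit_step_common_subseq:
  assumes "(edit_step ^^ t) a b"
  shows "\<exists>c. subseq c a \<and> subseq c b \<and> length a + length b \<le> t + 2 * length c"
  using assms
proof (induction t arbitrary: b)
  case 0
  then show ?case by (intro exI[of _ a]) auto
next
  case (Suc t)
  then obtain b' where b': "(edit_step ^^ t) a b'" "edit_step b' b" by auto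
  from Suc.IH[OF b'(1)] obtain c where c: "subseq c a" "subseq c b'"
    "length a + length b' \<le> t + 2 * length c" by blast
  from b'(2) consider
      (ins) u x v where "b' = u @ v" "b = u @ x # v"
    | (del) u x v where "b' = u @ x # v" "b = u @ v"
    unfolding edit_step_def by blast
  then show ?case
  proof cases
    case ins
    have "subseq b' b" unfolding ins by (intro list_emb_append_mono) auto
    then have "subseq c b" using c(2) subseq_order.trans by blast
    then show ?thesis using c ins by (intro exI[of _ c]) auto
  next
    case del
    obtain c1 c2 where c12: "c = c1 @ c2" "subseq c1 u" "subseq c2 (x # v)"
      using c(2) unfolding del(1) by (auto elim: subseq_appendE)
    \<comment> \<open>Dropping the first symbol of \<open>c2\<close> suffices, because its other
      symbols embed behind the deleted \<open>x\<close>.\<close>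
    obtain c3 where c3: "subseq c3 c2" "subseq c3 v" "length c2 \<le> Suc (length c3)"
    proof (cases c2)
      case Nil
      then show ?thesis using that[of "[]"] by auto
    next
      case (Cons y ys)
      have "subseq ys v" using c12(3) unfolding Cons by (auto split: if_splits dest: subseq_Cons')
      then show ?thesis using that[of ys] Cons by auto
    qed
    have "subseq (c1 @ c3) c" unfolding c12(1) using c3(1) by (intro list_emb_append_mono) auto
    then have "subseq (c1 @ c3) a" using c(1) subseq_order.trans by blast
    moreover have "subseq (c1 @ c3) b" unfolding del(2) using c12(2) c3(2)
      by (intro list_emb_append_mono)
    ultimately show ?thesis using c(3) c3(3) c12(1) del
      by (intro exI[of _ "c1 @ c3"]) auto
  qed
qed

text \<open>Turns upper bounds on the length of common subsequences into lower bounds on the edit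
  distance.\<close>

corollary ED_common_subseq:
  obtains c where "subseq c a" "subseq c b" "length a + length b \<le> ED a b + 2 * length c"
  using relpowp_edit_step_common_subseq[OF relpowp_edit_step_ED] by blast

section \<open>Positions of the first and the last matched symbol\<close>

lemma subseq_Cons_map_uptE:
  assumes "subseq (z # c) (map f [i..<j])"
  obtains p where "i \<le> p" "p < j" "f p = z" "subseq c (map f [Suc p..<j])"
proof -
  have "subseq (z # c) (map f [i..<j]) \<Longrightarrow>
      \<exists>p. i \<le> p \<and> p < j \<and> f p = z \<and> subseq c (map f [Suc p..<j])"
  proof (induction "j - i" arbitrary: i)
    case (Suc d)
    then have "[i..<j] = i # [Suc i..<j]" by (simp add: upt_conv_Cons)
    with Suc.prems consider "f i = z" "subseq c (map f [Suc i..<j])"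
      | "subseq (z # c) (map f [Suc i..<j])" by (auto split: if_splits)
    then show ?case
    proof cases
      case 2
      moreover have "d = j - Suc i" using Suc.hyps(2) by simp
      ultimately obtain p where "Suc i \<le> p" "p < j" "f p = z" "subseq c (map f [Suc p..<j])"
        using Suc.hyps(1)[of "Suc i"] by blast
      then show ?thesis using Suc_leD by blast
    qed (use Suc in \<open>auto intro!: exI[of _ i]\<close>)
  qed auto
  then show thesis using assms that by blast
qed

lemma subseq_snoc_snocE:
  assumes "subseq c (l @ [z])"
  obtains "subseq c l" | c' where "c = c' @ [z]" "subseq c' l"
proof -
  obtain c1 c2 where c: "c = c1 @ c2" "subseq c1 l" "subseq c2 [z]"
    using assms by (auto elim: subseq_appendE)
  then show thesis using that by (cases c2) (auto split: if_splits)
qed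

lemma subseq_snoc_map_uptE:
  assumes "subseq (c @ [z]) (map f [i..<j])"
  obtains p where "i \<le> p" "p < j" "f p = z" "subseq c (map f [i..<p])"
proof -
  have "subseq (c @ [z]) (map f [i..<j]) \<Longrightarrow>
      \<exists>p. i \<le> p \<and> p < j \<and> f p = z \<and> subseq c (map f [i..<p])"
  proof (induction j)
    case (Suc j)
    show ?case
    proof (cases "i \<le> j")
      case True
      then have "subseq (c @ [z]) (map f [i..<j] @ [f j])" using Suc.prems by simp
      then show ?thesis
      proof (cases rule: subseq_snoc_snocE)
        case 1
        then show ?thesis using Suc.IH by (meson less_SucI)
      next
        case (2 c')
        then show ?thesis using True by (intro exI[of _ j]) auto
      qed
    qed (use Suc in auto)
  qed auto
  then show thesis using assms that by blast
qed

text \<open>Passes from positions counted from 1, as in \<open>substr\<close>, to the indices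
  counted from 0 that the potential uses.\<close>

lemma substr_map_upt:
  assumes "1 \<le> i" "j \<le> n + 1"
  shows "substr (map f [0..<n]) i j = map f [i - 1..<j - 1]"
proof -
  have "i \<le> j \<Longrightarrow> i - 1 + (j - i) = j - 1" using assms by simp
  then show ?thesis using assms by (cases "i \<le> j") (auto simp: substr_def drop_map take_map take_upt)
qed

section \<open>The potential\<close>

text \<open>Convolution with a geometric sequence: the value is the sum of
  \<open>c ^ (x - Suc i) * f i\<close> over \<open>i < x\<close>. The recursive form is the one the
  machine evaluates, with multiplications by a constant only.\<close>

primrec horner :: "nat \<Rightarrow> (nat \<Rightarrow> nat) \<Rightarrow> nat \<Rightarrow> nat" where
  "horner c f 0 = 0"
| "horner c f (Suc x) = c * horner c f x + f x"

lemma horner_cong: "(\<And>i. i < x \<Longrightarrow> f i = g i) \<Longrightarrow> horner c f x = horner c g x"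
  by (induction x) auto

lemma horner_mono: "(\<And>i. i < x \<Longrightarrow> f i \<le> g i) \<Longrightarrow> horner c f x \<le> horner c g x"
  by (induction x) (auto intro!: add_mono)

lemma horner_add: "horner c (\<lambda>i. f i + g i) x = horner c f x + horner c g x"
  by (induction x) (auto simp: algebra_simps)

lemma horner_mult: "horner c (\<lambda>i. k * f i) x = k * horner c f x"
  by (induction x) (auto simp: algebra_simps)

lemma horner_sum: "horner c (\<lambda>i. \<Sum>a\<in>A. f a i) x = (\<Sum>a\<in>A. horner c (f a) x)"
  by (induction x) (auto simp: sum.distrib sum_distrib_left)

lemma horner_ge_term: "i < x \<Longrightarrow> c ^ (x - Suc i) * f i \<le> horner c f x"
proof (induction x)
  case (Suc x)
  show ?case
  proof (cases "i = x")
    case False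
    with Suc have "i < x" by simp
    then have "c ^ (Suc x - Suc i) * f i = c * (c ^ (x - Suc i) * f i)"
      by (simp add: Suc_diff_Suc flip: power_Suc mult.assoc)
    also have "\<dots> \<le> c * horner c f x" using Suc.IH \<open>i < x\<close> by simp
    finally show ?thesis by simp
  qed simp
qed simp

text \<open>The iterated sum has as coefficients the sums of \<open>m ^ i * (m + d) ^ j\<close> over
  fixed \<open>i + j\<close>, and \<open>d\<close> times such a sum telescopes to a difference of
  two powers. For \<open>d >= 1\<close> the iterated sum is thus at most the simple one.\<close>

lemma horner_horner: "d * horner (m + d) (horner m f) x + horner m f x = horner (m + d) f x"
proof (induction x)
  case (Suc x)
  have "d * horner (m + d) (horner m f) (Suc x) + horner m f (Suc x)
      = (m + d) * (d * horner (m + d) (horner m f) x + horner m f x) + f x"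
    by (simp add: algebra_simps)
  then show ?case using Suc by simp
qed simp

text \<open>The exact value is the geometric sum \<open>(m + 2) ^ k - (m + 1) ^ k\<close>.\<close>

lemma horner_power_le: "horner (Suc m) (\<lambda>x. (m + 2) ^ x) k \<le> (m + 2) ^ k"
proof (induction k)
  case (Suc k)
  have "Suc m * horner (Suc m) (\<lambda>x. (m + 2) ^ x) k \<le> Suc m * (m + 2) ^ k"
    using Suc by (rule mult_le_mono2)
  then show ?case by simp
qed simp

lemma horner_power_same: "d * horner d (\<lambda>x. d ^ x) k = k * d ^ k"
  by (induction k) (auto simp: algebra_simps)

text \<open>
  \<open>match_weight m S b e x\<close> is the weight, scaled by \<open>D ^ (x + e)\<close>, of all common subsequences whose
  right positions lie in \<open>b..b + e\<close> and start with \<open>b\<close>, and whose left positions end with \<open>x\<close>.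
  In \<open>start_potential\<close>, the two summands are the parts of the potential with distance weights
  \<open>\<theta> ^ d\<close> and \<open>1 / n\<close>, scaled by \<open>n * D ^ (b + e - 1)\<close>.
\<close>

primrec match_weight :: "nat \<Rightarrow> (nat \<Rightarrow> nat) \<Rightarrow> nat \<Rightarrow> nat \<Rightarrow> nat \<Rightarrow> nat" where
  "match_weight m S b 0 = (\<lambda>x. of_bool (S x = S b) * (m + 2) ^ x)"
| "match_weight m S b (Suc e) = (\<lambda>x. m * match_weight m S b e x
     + 4 * m ^ 2 * (of_bool (S x = S (b + Suc e)) * horner m (match_weight m S b e) x))"

definition start_potential :: "nat \<Rightarrow> nat \<Rightarrow> (nat \<Rightarrow> nat) \<Rightarrow> nat \<Rightarrow> nat \<Rightarrow> nat" where
  "start_potential m n S b e = n * horner (m + 1) (match_weight m S b e) b + horner (m + 2) (match_weight m S b e) b"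

text \<open>Every right window ends at position \<open>k - 1\<close>, whatever its start
  \<open>b\<close>, so with \<open>D = m + 2\<close> all summands share the scale
  \<open>n * D ^ (k - 2)\<close>.\<close>

definition potential :: "nat \<Rightarrow> nat \<Rightarrow> (nat \<Rightarrow> nat) \<Rightarrow> nat \<Rightarrow> nat" where
  "potential m n S k = (\<Sum>b<k. start_potential m n S b (k - Suc b))"

text \<open>Divided by its scale, the potential is at most 1/4.\<close>

definition good :: "nat \<Rightarrow> nat \<Rightarrow> (nat \<Rightarrow> nat) \<Rightarrow> nat \<Rightarrow> bool" where
  "good m n S k \<longleftrightarrow> 4 * (m + 2) ^ 2 * potential m n S k \<le> n * (m + 2) ^ k"

section \<open>Dependence on a prefix of the string\<close>

lemma match_weight_cong:
  "(\<And>i. i \<le> b + e \<Longrightarrow> S i = S' i) \<Longrightarrow> x < b \<Longrightarrow> match_weight m S b e x = match_weight m S' b e x"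
proof (induction e arbitrary: x)
  case (Suc e)
  then have "horner m (match_weight m S b e) x = horner m (match_weight m S' b e) x"
    by (intro horner_cong) auto
  then show ?case using Suc by simp
qed simp

lemma start_potential_cong:
  assumes "\<And>i. i \<le> b + e \<Longrightarrow> S i = S' i"
  shows "start_potential m n S b e = start_potential m n S' b e"
proof -
  have "horner c (match_weight m S b e) b = horner c (match_weight m S' b e) b" for c
    using assms by (intro horner_cong match_weight_cong)
  then show ?thesis by (simp add: start_potential_def)
qed

lemma potential_cong:
  assumes "\<And>i. i < k \<Longrightarrow> S i = S' i"
  shows "potential m n S k = potential m n S' k"
  unfolding potential_def using assms by (intro sum.cong start_potential_cong) auto

text \<open>This makes a greedy choice sound: symbols written later do not affect whether a prefix
  is good.\<close>

lemma good_cong: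
  assumes "\<And>i. i < k \<Longrightarrow> S i = S' i"
  shows "good m n S k \<longleftrightarrow> good m n S' k"
  unfolding good_def using potential_cong[OF assms] by simp

section \<open>Averaging over the next symbol\<close>

lemma sum_of_bool_eq_le:
  fixes y :: nat
  shows "(\<Sum>a<q. of_bool (y = a)) \<le> (1::nat)"
proof -
  have "(\<Sum>a<q. of_bool (y = a)) = (\<Sum>a\<in>{..<q} \<inter> {y}. 1::nat)"
    by (intro sum.mono_neutral_cong_right) auto
  also have "\<dots> \<le> 1" by (simp add: Int_insert_right)
  finally show ?thesis .
qed

text \<open>These are the windows that start at the new position \<open>k\<close>. A left position
  agrees with the new symbol for at most one of the \<open>q\<close> choices, so the sum over all
  choices counts each left position at most once. In the part with weight \<open>1 / n\<close> there
  are \<open>k\<close> equal terms, and \<open>k <= n\<close> bounds them.\<close>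

lemma sum_start_potential_fresh:
  assumes "k \<le> n"
  shows "(m + 2) * (\<Sum>a<q. start_potential m n (S(k := a)) k 0) \<le> n * (m + 3) * (m + 2) ^ k"
proof -
  have le: "(\<Sum>a<q. horner c (match_weight m (S(k := a)) k 0) k) \<le> horner c (\<lambda>x. (m + 2) ^ x) k" for c
  proof -
    have "(\<Sum>a<q. horner c (match_weight m (S(k := a)) k 0) k)
        = horner c (\<lambda>x. \<Sum>a<q. match_weight m (S(k := a)) k 0 x) k"
      by (rule horner_sum[symmetric])
    also have "\<dots> \<le> horner c (\<lambda>x. (m + 2) ^ x) k"
    proof (rule horner_mono)
      fix x assume "x < k"
      then have "(\<Sum>a<q. match_weight m (S(k := a)) k 0 x) = (\<Sum>a<q. of_bool (S x = a)) * (m + 2) ^ x"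
        by (simp add: sum_distrib_right)
      also have "\<dots> \<le> 1 * (m + 2) ^ x" by (intro mult_le_mono1 sum_of_bool_eq_le)
      finally show "(\<Sum>a<q. match_weight m (S(k := a)) k 0 x) \<le> (m + 2) ^ x" by simp
    qed
    finally show ?thesis .
  qed
  have "(\<Sum>a<q. start_potential m n (S(k := a)) k 0)
      = n * (\<Sum>a<q. horner (m + 1) (match_weight m (S(k := a)) k 0) k)
        + (\<Sum>a<q. horner (m + 2) (match_weight m (S(k := a)) k 0) k)"
    by (simp add: start_potential_def sum.distrib sum_distrib_left)
  also have "\<dots> \<le> n * (m + 2) ^ k + horner (m + 2) (\<lambda>x. (m + 2) ^ x) k"
    using le[of "m + 1"] le[of "m + 2"] horner_power_le[of m k]
    by (intro add_mono mult_le_mono2) auto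
  finally have "(m + 2) * (\<Sum>a<q. start_potential m n (S(k := a)) k 0)
      \<le> (m + 2) * (n * (m + 2) ^ k + horner (m + 2) (\<lambda>x. (m + 2) ^ x) k)"
    by (rule mult_le_mono2)
  also have "\<dots> = (m + 2) * n * (m + 2) ^ k + k * (m + 2) ^ k"
    using horner_power_same[of "m + 2" k] by (simp only: distrib_left mult.assoc)
  also have "\<dots> \<le> (m + 2) * n * (m + 2) ^ k + n * (m + 2) ^ k" using assms by simp
  finally show ?thesis by (simp add: algebra_simps)
qed

text \<open>Leaving the new position unmatched gives the factor \<open>m\<close> for each of the
  \<open>q\<close> choices, hence \<open>q * m\<close>. A given left position can be matched to it
  for at most one choice, hence \<open>4 * m ^ 2\<close>; the sum over skipped left positions is
  absorbed by \<open>horner_horner\<close>, as the base \<open>m + d\<close> exceeds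
  \<open>m\<close>.\<close>

lemma sum_start_potential_extend:
  assumes "k = b + Suc e"
  shows "(\<Sum>a<q. start_potential m n (S(k := a)) b (Suc e)) \<le> (q * m + 4 * m ^ 2) * start_potential m n S b e"
proof -
  have le: "(\<Sum>a<q. horner (m + d) (match_weight m (S(k := a)) b (Suc e)) b)
      \<le> (q * m + 4 * m ^ 2) * horner (m + d) (match_weight m S b e) b" if "d \<ge> 1" for d
  proof -
    let ?P = "horner m (match_weight m S b e)"
    have "(\<Sum>a<q. horner (m + d) (match_weight m (S(k := a)) b (Suc e)) b)
        = horner (m + d) (\<lambda>x. \<Sum>a<q. match_weight m (S(k := a)) b (Suc e) x) b"
      by (rule horner_sum[symmetric])
    also have "\<dots> \<le> horner (m + d) (\<lambda>x. q * m * match_weight m S b e x + 4 * m ^ 2 * ?P x) b"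
    proof (rule horner_mono)
      fix x assume x: "x < b"
      have *: "match_weight m (S(k := a)) b e y = match_weight m S b e y" if "y < b" for a y
        using assms that by (intro match_weight_cong) auto
      have "horner m (match_weight m (S(k := a)) b e) x = ?P x" for a
        using x by (intro horner_cong *) auto
      then have "(\<Sum>a<q. match_weight m (S(k := a)) b (Suc e) x)
          = (\<Sum>a<q. m * match_weight m S b e x + 4 * m ^ 2 * (of_bool (S x = a) * ?P x))"
        using assms x * by (intro sum.cong) auto
      also have "\<dots> = q * m * match_weight m S b e x + 4 * m ^ 2 * ((\<Sum>a<q. of_bool (S x = a)) * ?P x)"
        by (simp only: sum.distrib sum_distrib_left sum_distrib_right sum_constant) simp
      also have "\<dots> \<le> q * m * match_weight m S b e x + 4 * m ^ 2 * (1 * ?P x)"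
        by (intro add_mono mult_le_mono mult_le_mono1 sum_of_bool_eq_le order_refl)
      finally show "(\<Sum>a<q. match_weight m (S(k := a)) b (Suc e) x)
          \<le> q * m * match_weight m S b e x + 4 * m ^ 2 * ?P x" by simp
    qed
    also have "\<dots> = q * m * horner (m + d) (match_weight m S b e) b + 4 * m ^ 2 * horner (m + d) ?P b"
      by (simp only: horner_add horner_mult)
    also have "\<dots> \<le> q * m * horner (m + d) (match_weight m S b e) b
        + 4 * m ^ 2 * horner (m + d) (match_weight m S b e) b"
    proof (intro add_left_mono mult_le_mono2)
      have "horner (m + d) ?P b \<le> d * horner (m + d) ?P b" using that by simp
      then show "horner (m + d) ?P b \<le> horner (m + d) (match_weight m S b e) b"
        using horner_horner[of d m "match_weight m S b e" b] by linarith
    qed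
    finally show ?thesis by (simp add: algebra_simps)
  qed
  have "(\<Sum>a<q. start_potential m n (S(k := a)) b (Suc e))
      = n * (\<Sum>a<q. horner (m + 1) (match_weight m (S(k := a)) b (Suc e)) b)
        + (\<Sum>a<q. horner (m + 2) (match_weight m (S(k := a)) b (Suc e)) b)"
    unfolding start_potential_def by (simp only: sum.distrib sum_distrib_left)
  also have "\<dots> \<le> n * ((q * m + 4 * m ^ 2) * horner (m + 1) (match_weight m S b e) b)
        + (q * m + 4 * m ^ 2) * horner (m + 2) (match_weight m S b e) b"
    using le[of 1] le[of 2] by (intro add_mono mult_le_mono2) auto
  finally show ?thesis by (simp add: start_potential_def algebra_simps)
qed

lemma sum_potential_Suc:
  assumes "k \<le> n"
  shows "(m + 2) * (\<Sum>a<q. potential m n (S(k := a)) (Suc k))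
    \<le> (m + 2) * (q * m + 4 * m ^ 2) * potential m n S k + n * (m + 3) * (m + 2) ^ k"
proof -
  have split: "(\<Sum>a<q. potential m n (S(k := a)) (Suc k))
      = (\<Sum>b<k. \<Sum>a<q. start_potential m n (S(k := a)) b (k - b)) + (\<Sum>a<q. start_potential m n (S(k := a)) k 0)"
    unfolding potential_def by (simp add: sum.distrib sum.swap[of _ "{..<q}"])
  have "(\<Sum>b<k. \<Sum>a<q. start_potential m n (S(k := a)) b (k - b))
      \<le> (\<Sum>b<k. (q * m + 4 * m ^ 2) * start_potential m n S b (k - Suc b))"
  proof (rule sum_mono)
    fix b assume "b \<in> {..<k}"
    then have "k - b = Suc (k - Suc b)" "k = b + Suc (k - Suc b)" by auto
    then show "(\<Sum>a<q. start_potential m n (S(k := a)) b (k - b))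
        \<le> (q * m + 4 * m ^ 2) * start_potential m n S b (k - Suc b)"
      using sum_start_potential_extend[of k b "k - Suc b" m n S q] by simp
  qed
  also have "\<dots> = (q * m + 4 * m ^ 2) * potential m n S k"
    by (simp add: potential_def sum_distrib_left)
  finally have "(m + 2) * (\<Sum>a<q. potential m n (S(k := a)) (Suc k))
      \<le> (m + 2) * ((q * m + 4 * m ^ 2) * potential m n S k + (\<Sum>a<q. start_potential m n (S(k := a)) k 0))"
    unfolding split by (intro mult_le_mono2 add_right_mono)
  also have "\<dots> \<le> (m + 2) * (q * m + 4 * m ^ 2) * potential m n S k + n * (m + 3) * (m + 2) ^ k"
    using sum_start_potential_fresh[OF assms, of m S q] by (subst distrib_left, subst mult.assoc) linarith
  finally show ?thesis .
qed

lemma good_0: "good m n S 0"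
  by (simp add: good_def potential_def)

text \<open>If all \<open>q\<close> symbols were bad, adding up their potentials would contradict
  the bound of \<open>sum_potential_Suc\<close> on the total.\<close>

lemma exists_good_symbol:
  assumes "good m n S k" "k < n"
  shows "\<exists>a<8 * (m + 2) ^ 2. good m n (S(k := a)) (Suc k)"
proof (rule ccontr)
  define d where "d = m + 2"
  define q where "q = 8 * d ^ 2"
  let ?N = "n * d ^ k"
  assume "\<not> ?thesis"
  then have bad: "n * d ^ Suc k < 4 * d ^ 2 * potential m n (S(k := a)) (Suc k)" if "a < q" for a
    using that by (auto simp: good_def d_def q_def not_le)
  have "q > 0" by (simp add: q_def d_def)
  have d: "m + 2 = d" "m + 3 = d + 1" by (simp_all add: d_def)
  have "q * (n * d ^ Suc k) = (\<Sum>a<q. n * d ^ Suc k)" by simp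
  also have "\<dots> < (\<Sum>a<q. 4 * d ^ 2 * potential m n (S(k := a)) (Suc k))"
    using bad \<open>q > 0\<close> by (intro sum_strict_mono) auto
  also have "\<dots> = 4 * d * (d * (\<Sum>a<q. potential m n (S(k := a)) (Suc k)))"
    by (simp add: sum_distrib_left power2_eq_square mult.assoc)
  also have "\<dots> \<le> 4 * d * (d * (q * m + 4 * m ^ 2) * potential m n S k + n * (d + 1) * d ^ k)"
    using sum_potential_Suc[where k = k and n = n and m = m and q = q and S = S] assms(2)
    unfolding d by (intro mult_le_mono2) simp
  also have "\<dots> = (q * m + 4 * m ^ 2) * (4 * d ^ 2 * potential m n S k) + 4 * d * (d + 1) * ?N"
    by (simp add: algebra_simps power2_eq_square)
  also have "\<dots> \<le> (q * m + 4 * m ^ 2) * ?N + 4 * d * (d + 1) * ?N"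
    using assms(1) by (intro add_mono mult_le_mono2) (auto simp: good_def d_def)
  also have "\<dots> = (q * m + 4 * m ^ 2 + 4 * d * (d + 1)) * ?N"
    by (simp add: algebra_simps)
  also have "\<dots> \<le> (q * d) * ?N"
  proof (rule mult_le_mono1)
    \<comment> \<open>As \<open>d = m + 2\<close>, \<open>q * d\<close> exceeds \<open>q * m\<close>
      by \<open>2 * q = 16 * d ^ 2\<close>. This slack pays for the new matched pairs and for the
      fresh windows, and it dictates the size of the alphabet.\<close>
    have "4 * m ^ 2 + 4 * d * (d + 1) \<le> 2 * q"
      by (simp add: q_def d_def power2_eq_square algebra_simps)
    then show "q * m + 4 * m ^ 2 + 4 * d * (d + 1) \<le> q * d"
      by (simp add: d_def algebra_simps)
  qed
  finally show False by (simp add: mult.left_commute mult.assoc)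
qed

section \<open>A long common subsequence forces a large potential\<close>

text \<open>The weight sums over all matchings, so a single one bounds it from below. Its first pair
  is \<open>p\<close> and \<open>b\<close>, and \<open>c\<close> lists the symbols after that pair;
  \<open>y\<close> is the left position of the last pair. Each of the \<open>y - p\<close> left and
  \<open>e\<close> right positions after the first pair costs a factor \<open>m\<close>. The
  \<open>max\<close> covers an empty \<open>c\<close>, where \<open>y = p\<close> need not be below
  \<open>x\<close>.\<close>

lemma match_weight_ge_common_subseq:
  assumes "S p = S b" "p < b"
  shows "subseq c (map S [Suc p..<x]) \<Longrightarrow> subseq c (map S [Suc b..<Suc (b + e)]) \<Longrightarrow>
    \<exists>y\<ge>p. y < max x (Suc p) \<and> 4 ^ length c * m ^ (y - p + e) * (m + 2) ^ p \<le> match_weight m S b e y"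
proof (induction e arbitrary: c x)
  case 0
  then have "c = []" by (cases c) auto
  then show ?case using assms by (intro exI[of _ p]) auto
next
  case (Suc e)
  have "subseq c (map S [Suc b..<Suc (b + e)] @ [S (b + Suc e)])"
    using Suc.prems(2) by simp
  then show ?case
  proof (cases rule: subseq_snoc_snocE)
    case 1
    from Suc.IH[OF Suc.prems(1) this] obtain y where y: "p \<le> y" "y < max x (Suc p)"
      "4 ^ length c * m ^ (y - p + e) * (m + 2) ^ p \<le> match_weight m S b e y" by blast
    have "4 ^ length c * m ^ (y - p + Suc e) * (m + 2) ^ p
        = m * (4 ^ length c * m ^ (y - p + e) * (m + 2) ^ p)" by (simp add: mult_ac)
    also have "\<dots> \<le> m * match_weight m S b e y" using y(3) by (rule mult_le_mono2)
    also have "\<dots> \<le> match_weight m S b (Suc e) y" by simp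
    finally show ?thesis using y by blast
  next
    case (2 c')
    from Suc.prems(1)[unfolded 2(1)] obtain y' where y': "Suc p \<le> y'" "y' < x"
      "S y' = S (b + Suc e)" "subseq c' (map S [Suc p..<y'])"
      by (rule subseq_snoc_map_uptE)
    from Suc.IH[OF y'(4) 2(2)] obtain y where y: "p \<le> y" "y < max y' (Suc p)"
      "4 ^ length c' * m ^ (y - p + e) * (m + 2) ^ p \<le> match_weight m S b e y" by blast
    then have "y < y'" using y'(1) by simp
    \<comment> \<open>The factor \<open>m ^ 2\<close> pays for the new pair \<open>y'\<close> and
      \<open>b + Suc e\<close>, the power inside \<open>horner\<close> for the
      \<open>y' - Suc y\<close> left positions skipped before it.\<close>
    have exp: "y' - p + Suc e = (2 + (y' - Suc y)) + (y - p + e)" using \<open>y < y'\<close> y(1) by simp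
    have "4 ^ length c * m ^ (y' - p + Suc e) * (m + 2) ^ p
        = 4 * m ^ 2 * (m ^ (y' - Suc y) * (4 ^ length c' * m ^ (y - p + e) * (m + 2) ^ p))"
      unfolding exp 2(1) by (simp only: power_add length_append) (simp add: mult_ac)
    also have "\<dots> \<le> 4 * m ^ 2 * (m ^ (y' - Suc y) * match_weight m S b e y)"
      using y(3) by (intro mult_le_mono2)
    also have "\<dots> \<le> 4 * m ^ 2 * horner m (match_weight m S b e) y'"
      using horner_ge_term[OF \<open>y < y'\<close>] by (intro mult_le_mono2)
    also have "\<dots> \<le> match_weight m S b (Suc e) y'" using y'(3) by simp
    finally show ?thesis using y' by (intro exI[of _ y']) auto
  qed
qed

text \<open>Compares one summand with the whole potential. In the far part the gap between the
  windows carries the factor \<open>d ^ (b - Suc y)\<close>, which cancels against the scale: only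
  positions inside the windows count, at the price of a factor \<open>n\<close>. In the near part
  \<open>n\<close> cancels, but the gap is counted in \<open>t\<close>.\<close>

lemma good_common_subseq:
  assumes good: "good m n S k'" and c: "subseq c (map S [i..<j])" "subseq c (map S [i'..<k'])" "c \<noteq> []"
    and ord: "j \<le> i'" "i' \<le> k'" "n > 0"
  shows "\<exists>t\<le>(j - i) + (k' - i'). 4 ^ length c * m ^ t \<le> n * (m + 2) ^ t"
    and "\<exists>t\<le>k' - i. 4 ^ length c * m ^ t \<le> (m + 2) ^ t"
proof -
  define d where "d = m + 2"
  obtain z c' where c': "c = z # c'" using c(3) by (cases c) auto
  obtain p where p: "i \<le> p" "p < j" "S p = z" "subseq c' (map S [Suc p..<j])"
    using c(1) unfolding c' by (rule subseq_Cons_map_uptE)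
  obtain b where b: "i' \<le> b" "b < k'" "S b = z" "subseq c' (map S [Suc b..<k'])"
    using c(2) unfolding c' by (rule subseq_Cons_map_uptE)
  define e where "e = k' - Suc b"
  have k': "k' = Suc (b + e)" using b by (simp add: e_def)
  have "p < b" using p b ord by simp
  obtain y where y: "p \<le> y" "y < j" "4 ^ length c' * m ^ (y - p + e) * d ^ p \<le> match_weight m S b e y"
    using match_weight_ge_common_subseq[of S p b c' j e m] p b \<open>p < b\<close> unfolding k' d_def by auto
  have "y < b" using y b ord by simp
  have "start_potential m n S b e \<le> potential m n S k'"
    unfolding potential_def by (rule order_trans[OF _ member_le_sum[of b]]) (auto simp: k')
  then have "4 * d ^ 2 * start_potential m n S b e \<le> 4 * d ^ 2 * potential m n S k'"
    by (rule mult_le_mono2)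
  also have "\<dots> \<le> n * d ^ k'" using good by (simp add: good_def d_def)
  finally have bp: "4 * d ^ 2 * start_potential m n S b e \<le> n * d ^ k'" .
  define M where "M = 4 ^ length c' * m ^ (y - p + e) * d ^ p"
  have near: "(m + 1) ^ (b - Suc y) * M \<le> horner (m + 1) (match_weight m S b e) b"
    using y(3) horner_ge_term[OF \<open>y < b\<close>] unfolding M_def by (meson mult_le_mono2 order_trans)
  have far: "d ^ (b - Suc y) * M \<le> horner d (match_weight m S b e) b"
    using y(3) horner_ge_term[OF \<open>y < b\<close>] unfolding M_def by (meson mult_le_mono2 order_trans)
  show "\<exists>t\<le>(j - i) + (k' - i'). 4 ^ length c * m ^ t \<le> n * (m + 2) ^ t"
  proof (intro exI conjI)
    let ?t = "y - p + e"
    show "?t \<le> (j - i) + (k' - i')" using y p b k' by simp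
    have exp: "k' = 2 + (b - Suc y) + p + ?t" using \<open>y < b\<close> y(1) k' by simp
    \<comment> \<open>The first pair has weight 1 in \<open>match_weight\<close>. Its missing factor
      4 comes from the bound 1/4 in \<open>good\<close>, which turns \<open>length c'\<close> into
      \<open>length c\<close>.\<close>
    have "d ^ (2 + (b - Suc y) + p) * (4 ^ length c * m ^ ?t) = 4 * d ^ 2 * (d ^ (b - Suc y) * M)"
      unfolding M_def c' by (simp only: power_add list.size) (simp add: mult_ac)
    also have "\<dots> \<le> 4 * d ^ 2 * start_potential m n S b e"
      using far by (intro mult_le_mono2) (simp add: start_potential_def d_def)
    also have "\<dots> \<le> n * d ^ k'" by (rule bp)
    also have "\<dots> = d ^ (2 + (b - Suc y) + p) * (n * d ^ ?t)"
      by (subst exp, subst power_add) (simp add: mult_ac)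
    finally show "4 ^ length c * m ^ ?t \<le> n * (m + 2) ^ ?t"
      by (simp add: d_def)
  qed
  show "\<exists>t\<le>k' - i. 4 ^ length c * m ^ t \<le> (m + 2) ^ t"
  proof (intro exI conjI)
    let ?t = "b - Suc y + (y - p + e)"
    show "?t \<le> k' - i" using y p b k' \<open>y < b\<close> by simp
    have exp: "k' = 2 + p + ?t" using \<open>y < b\<close> y(1) k' by simp
    have "n * d ^ (2 + p) * (4 ^ length c * m ^ ?t)
        = 4 * d ^ 2 * (n * (m ^ (b - Suc y) * M))"
      unfolding M_def c' by (simp only: power_add list.size) (simp add: mult_ac)
    \<comment> \<open>Lowering the base from \<open>m + 1\<close> to \<open>m\<close> charges a gap
      position like a position inside a window.\<close>
    also have "\<dots> \<le> 4 * d ^ 2 * (n * ((m + 1) ^ (b - Suc y) * M))"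
      by (intro mult_le_mono2 mult_le_mono1 power_mono) auto
    also have "\<dots> \<le> 4 * d ^ 2 * start_potential m n S b e"
      using near by (intro mult_le_mono2) (simp add: start_potential_def trans_le_add1)
    also have "\<dots> \<le> n * d ^ k'" by (rule bp)
    also have "\<dots> = n * d ^ (2 + p) * d ^ ?t"
      by (subst exp, subst power_add) (simp add: mult_ac)
    finally show "4 ^ length c * m ^ ?t \<le> (m + 2) ^ ?t"
      using ord(3) by (simp add: d_def)
  qed
qed

section \<open>From the potential to the synchronization property\<close>

text \<open>Take logarithms: \<open>ln (m + 2) - ln m <= 2 / m\<close>, which is at most
  \<open>\<epsilon> / 4\<close> by the choice of \<open>m\<close>. Then divide by
  \<open>ln 4\<close>, which is at least 1 and turns \<open>ln n\<close> into
  \<open>log 2 n / 2\<close>.\<close>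

lemma common_subseq_length_le:
  assumes "4 ^ r * m ^ t \<le> n * (m + 2) ^ t" "t \<le> l" "0 < \<epsilon>" "8 / \<epsilon> \<le> real m" "n > 0"
  shows "real r \<le> \<epsilon> * real l / 4 + log 2 (real n) / 2"
proof -
  have "8 / \<epsilon> > 0" using assms(3) by simp
  then have m: "real m > 0" using assms(4) by linarith
  have "real (4 ^ r * m ^ t) \<le> real (n * (m + 2) ^ t)"
    using assms(1) by (rule of_nat_mono)
  then have "4 ^ r * real m ^ t \<le> real n * (real m + 2) ^ t" by (simp add: add.commute)
  moreover have "0 < 4 ^ r * real m ^ t" using m by simp
  ultimately have "ln (4 ^ r * real m ^ t) \<le> ln (real n * (real m + 2) ^ t)"
    by (rule ln_mono)
  moreover have "ln (4 ^ r * real m ^ t) = real r * ln 4 + real t * ln (real m)"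
    using m by (simp add: ln_mult ln_realpow)
  moreover have "ln (real n * (real m + 2) ^ t) = ln (real n) + real t * ln (real m + 2)"
    using m assms(5) by (simp add: ln_mult ln_realpow)
  ultimately have "real r * ln 4 + real t * ln (real m) \<le> ln (real n) + real t * ln (real m + 2)"
    by (simp only:)
  moreover have "ln (real m + 2) \<le> ln m + \<epsilon> / 4"
  proof -
    have "ln ((real m + 2) / m) \<le> (real m + 2) / m - 1"
      using m by (intro ln_le_minus_one) auto
    also have "\<dots> = 2 / m" using m by (simp add: field_simps)
    also have "\<dots> \<le> \<epsilon> / 4" using assms(3,4) m by (simp add: field_simps)
    finally show ?thesis using m by (simp add: ln_div)
  qed
  then have "real t * ln (real m + 2) \<le> real t * (ln m + \<epsilon> / 4)" by (intro mult_left_mono) auto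
  moreover have "real t * (\<epsilon> / 4) \<le> real l * (\<epsilon> / 4)"
    using assms(2,3) by (intro mult_right_mono) auto
  ultimately have *: "real r * ln 4 \<le> ln n + \<epsilon> * real l / 4"
    by (simp add: algebra_simps)
  have ln4: "ln (4::real) = 2 * ln 2" using ln_realpow[of "2::real" 2] by simp
  have "1 \<le> ln (4::real)" using exp_le by (simp add: ln_ge_iff)
  then have "\<epsilon> * real l / 4 \<le> (\<epsilon> * real l / 4) * ln 4"
    using mult_left_mono[of 1 "ln 4" "\<epsilon> * real l / 4"] assms(3) by simp
  moreover have "ln (real n) = (log 2 (real n) / 2) * ln 4"
    unfolding ln4 log_def by simp
  ultimately have "real r * ln 4 \<le> (\<epsilon> * real l / 4 + log 2 (real n) / 2) * ln 4"
    using * by (simp add: algebra_simps)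
  then show ?thesis using \<open>1 \<le> ln 4\<close> by (subst (asm) mult_le_cancel_right_pos) auto
qed

text \<open>By \<open>ED_common_subseq\<close> it is enough that common subsequences of the two
  substrings are shorter than \<open>\<epsilon> * l / 2\<close>.\<close>

lemma long_distance_sync_string_if_good:
  assumes "0 < \<epsilon>" "8 / \<epsilon> \<le> real m" and good: "\<And>k. k \<le> n \<Longrightarrow> good m n S k"
  shows "long_distance_sync_string (2 / \<epsilon>) \<epsilon> (map S [0..<n])"
  unfolding long_distance_sync_string_def distance_sync_string_def Let_def length_map length_upt diff_zero
proof (intro allI impI)
  fix i j i' j' :: nat
  define l where "l = (j - i) + (j' - i')"
  assume ord: "1 \<le> i \<and> i < j \<and> j \<le> i' \<and> i' < j' \<and> j' \<le> n + 1"
    and "real (i' - j) \<le> real n * of_bool (2 / \<epsilon> * log 2 (real n) < real (j - i + (j' - i')))"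
  \<comment> \<open>If the indicator vanishes, then \<open>i' - j = 0\<close>, and the intervals are
    adjacent.\<close>
  then have dist: "i' = j \<or> 2 / \<epsilon> * log 2 n < l"
    by (auto simp: l_def split: if_splits)
  let ?a = "map S [i - 1..<j - 1]" and ?b = "map S [i' - 1..<j' - 1]"
  have sub: "substr (map S [0..<n]) i j = ?a" "substr (map S [0..<n]) i' j' = ?b"
    using ord by (intro substr_map_upt; simp)+
  obtain c where c: "subseq c ?a" "subseq c ?b" "length ?a + length ?b \<le> ED ?a ?b + 2 * length c"
    by (rule ED_common_subseq)
  have len: "length ?a + length ?b = l" using ord by (auto simp: l_def)
  have "l > 0" "n > 0" using ord by (auto simp: l_def)
  have "real (length c) < \<epsilon> * l / 2"
  proof (cases "c = []")
    case True
    then show ?thesis using assms(1) \<open>l > 0\<close> by simp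
  next
    case False
    have g: "good m n S (j' - 1)" using good ord by auto
    have "j - 1 \<le> i' - 1" "i' - 1 \<le> j' - 1" using ord by auto
    note bounds = good_common_subseq[OF g c(1,2) False this \<open>n > 0\<close>]
    from dist show ?thesis
    proof
      assume adj: "i' = j"
      then have "j' - 1 - (i - 1) \<le> l" using ord by (auto simp: l_def)
      moreover obtain t where "t \<le> j' - 1 - (i - 1)" "4 ^ length c * m ^ t \<le> (m + 2) ^ t"
        using bounds(2) by blast
      \<comment> \<open>For adjacent intervals the whole span has length \<open>l\<close>, so the
        bound without the factor \<open>n\<close> applies. With 1 in its place the logarithmic term
        disappears.\<close>
      ultimately have "t \<le> l" "4 ^ length c * m ^ t \<le> 1 * (m + 2) ^ t" by simp_all
      from common_subseq_length_le[OF this(2,1) assms(1,2)] have "real (length c) \<le> \<epsilon> * real l / 4" by simp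
      moreover have "0 < \<epsilon> * real l" using assms(1) \<open>l > 0\<close> by simp
      ultimately show ?thesis by linarith
    next
      assume far: "2 / \<epsilon> * log 2 n < l"
      have "(j - 1 - (i - 1)) + (j' - 1 - (i' - 1)) \<le> l" using ord by (auto simp: l_def)
      moreover obtain t where "t \<le> (j - 1 - (i - 1)) + (j' - 1 - (i' - 1))"
        "4 ^ length c * m ^ t \<le> n * (m + 2) ^ t"
        using bounds(1) by blast
      ultimately have "t \<le> l" "4 ^ length c * m ^ t \<le> n * (m + 2) ^ t" by simp_all
      \<comment> \<open>By \<open>far\<close>, the term \<open>log 2 n / 2\<close> is below
        \<open>\<epsilon> * l / 4\<close>; this is what fixes the constant
        \<open>2 / \<epsilon>\<close>.\<close>
      from common_subseq_length_le[OF this(2,1) assms(1,2) \<open>n > 0\<close>] show ?thesis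
        using far assms(1) by (simp add: field_simps)
    qed
  qed
  then have "(1 - \<epsilon>) * real l < real (ED ?a ?b)"
    using c(3) len by (simp add: algebra_simps)
  then show "(1 - \<epsilon>) * real (j - i + (j' - i'))
      < real (ED (substr (map S [0..<n]) i j) (substr (map S [0..<n]) i' j'))"
    unfolding sub l_def .
qed

section \<open>Running time of programs\<close>

text \<open>Total correctness with a bound on the number of steps. The postcondition may be another
  \<open>wp\<close>, so that sequences nest assertions and add their bounds.\<close>

definition wp :: "program \<Rightarrow> (state \<Rightarrow> bool) \<Rightarrow> nat \<Rightarrow> state \<Rightarrow> bool" where
  "wp p Q T s \<longleftrightarrow> (\<exists>t s'. runs p s t s' \<and> t \<le> T \<and> Q s')"

lemma wp_mono: "wp p Q T s \<Longrightarrow> (\<And>s'. Q s' \<Longrightarrow> Q' s') \<Longrightarrow> T \<le> T' \<Longrightarrow> wp p Q' T' s"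
  unfolding wp_def by (meson order_trans)

lemma wp_Seq: "wp p (wp p' Q T') T s \<Longrightarrow> wp (Seq p p') Q (T + T') s"
  unfolding wp_def by (meson runs.Seq add_mono)

primrec loop_free :: "program \<Rightarrow> bool" where
  "loop_free Skip \<longleftrightarrow> True"
| "loop_free (Write a e e') \<longleftrightarrow> True"
| "loop_free (Seq p p') \<longleftrightarrow> loop_free p \<and> loop_free p'"
| "loop_free (Cond e p p') \<longleftrightarrow> loop_free p \<and> loop_free p'"
| "loop_free (While e p) \<longleftrightarrow> False"

text \<open>\<open>exec\<close> and \<open>max_time\<close> are meaningful only for loop-free programs.\<close>

primrec exec :: "program \<Rightarrow> state \<Rightarrow> state" where
  "exec Skip s = s"
| "exec (Write a e e') s = s(a := (s a)(eval_expr e s := eval_expr e' s))"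
| "exec (Seq p p') s = exec p' (exec p s)"
| "exec (Cond e p p') s = (if eval_expr e s \<noteq> 0 then exec p s else exec p' s)"
| "exec (While e p) s = s"

primrec max_time :: "program \<Rightarrow> nat" where
  "max_time Skip = 1"
| "max_time (Write a e e') = cost_expr e + cost_expr e' + 1"
| "max_time (Seq p p') = max_time p + max_time p'"
| "max_time (Cond e p p') = cost_expr e + 1 + max (max_time p) (max_time p')"
| "max_time (While e p) = 0"

lemma runs_exec: "loop_free p \<Longrightarrow> \<exists>t\<le>max_time p. runs p s t (exec p s)"
proof (induction p arbitrary: s)
  case Skip
  then show ?case using runs.Skip by auto
next
  case (Write a e e')
  show ?case unfolding exec.simps max_time.simps using runs.Write by blast
next
  case (Seq p p')
  then obtain t t' where "t \<le> max_time p" "runs p s t (exec p s)"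
    "t' \<le> max_time p'" "runs p' (exec p s) t' (exec p' (exec p s))"
    by (metis loop_free.simps(3))
  then show ?case by (intro exI[of _ "t + t'"]) (auto intro: runs.Seq)
next
  case (Cond e p p')
  show ?case
  proof (cases "eval_expr e s = 0")
    case True
    obtain t where "t \<le> max_time p'" "runs p' s t (exec p' s)" using Cond by auto
    then show ?thesis using True
      by (intro exI[of _ "cost_expr e + 1 + t"]) (auto intro: runs.Cond_false[simplified])
  next
    case False
    obtain t where "t \<le> max_time p" "runs p s t (exec p s)" using Cond by auto
    then show ?thesis using False
      by (intro exI[of _ "cost_expr e + 1 + t"]) (auto intro: runs.Cond_true[simplified])
  qed
qed simp

lemma wp_loop_free: "loop_free p \<Longrightarrow> Q (exec p s) \<Longrightarrow> wp p Q (max_time p) s"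
  unfolding wp_def using runs_exec by blast

lemma wp_Seq_loop_free:
  assumes "loop_free p" "wp p' Q T (exec p s)"
  shows "wp (Seq p p') Q (max_time p + T) s"
  by (rule wp_Seq, rule wp_loop_free[OF assms(1)], rule assms(2))

section \<open>Scalar variables and counted loops\<close>

abbreviation var :: "nat \<Rightarrow> expr" where
  "var v \<equiv> Read v (Const 0)"

abbreviation assign :: "nat \<Rightarrow> expr \<Rightarrow> program" where
  "assign v e \<equiv> Write v (Const 0) e"

abbreviation set_var :: "nat \<Rightarrow> nat \<Rightarrow> state \<Rightarrow> state" where
  "set_var v y s \<equiv> s(v := (s v)(0 := y))"

text \<open>Subtraction is truncated, so the condition is nonzero exactly while the counter is below
  \<open>e\<close>. The limit \<open>e\<close> is evaluated anew in every round and has to be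
  preserved by the body.\<close>

definition for_loop :: "nat \<Rightarrow> expr \<Rightarrow> program \<Rightarrow> program" where
  "for_loop v e p = Seq (assign v (Const 0))
     (While (Sub e (var v)) (Seq p (assign v (Add (var v) (Const 1)))))"

text \<open>A round costs \<open>T\<close> for the body, \<open>cost_expr e + 4\<close> for the test
  and 6 for the increment; the failing test at the end costs \<open>cost_expr e + 4\<close>
  again.\<close>

lemma wp_while:
  assumes body: "\<And>i s. i < N \<Longrightarrow> I i s \<Longrightarrow> wp p (\<lambda>s'. I (Suc i) (set_var v (Suc (s' v 0)) s')) T s"
    and inv: "\<And>i s. i \<le> N \<Longrightarrow> I i s \<Longrightarrow> eval_expr e s = N \<and> s v 0 = i"
  shows "i \<le> N \<Longrightarrow> I i s \<Longrightarrow>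
    wp (While (Sub e (var v)) (Seq p (assign v (Add (var v) (Const 1))))) (I N)
      ((N - i) * (T + cost_expr e + 10) + cost_expr e + 4) s"
proof (induction "N - i" arbitrary: i s)
  case 0
  then have "i = N" "eval_expr (Sub e (var v)) s = 0" using inv by fastforce+
  then show ?case unfolding wp_def using 0 runs.While_false[of "Sub e (var v)" s]
    by (intro exI conjI) auto
next
  case (Suc d)
  let ?p = "Seq p (assign v (Add (var v) (Const 1)))"
  have "i < N" using Suc by simp
  then have cond: "eval_expr (Sub e (var v)) s \<noteq> 0" using inv Suc.prems by fastforce
  obtain t s1 where t: "runs p s t s1" "t \<le> T" "I (Suc i) (set_var v (Suc (s1 v 0)) s1)"
    using body[OF \<open>i < N\<close> Suc.prems(2)] unfolding wp_def by blast
  let ?s2 = "set_var v (Suc (s1 v 0)) s1"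
  have "runs (assign v (Add (var v) (Const 1))) s1 6 ?s2"
    using runs.Write[of v "Const 0" "Add (var v) (Const 1)" s1] by (simp add: eval_nat_numeral)
  with t(1) have run: "runs ?p s (t + 6) ?s2" by (rule runs.Seq)
  obtain t' s3 where t': "runs (While (Sub e (var v)) ?p) ?s2 t' s3"
    "t' \<le> (N - Suc i) * (T + cost_expr e + 10) + cost_expr e + 4" "I N s3"
  proof -
    have "d = N - Suc i" "Suc i \<le> N" using Suc.hyps(2) \<open>i < N\<close> by simp_all
    from Suc.hyps(1)[OF this t(3)] show thesis unfolding wp_def using that by blast
  qed
  have N: "N - i = Suc (N - Suc i)" using \<open>i < N\<close> by simp
  have "cost_expr (Sub e (var v)) + 1 + (t + 6) + t'
      \<le> (N - i) * (T + cost_expr e + 10) + cost_expr e + 4"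
    unfolding N using t(2) t'(2) by simp
  then show ?case unfolding wp_def
    using runs.While_true[OF cond run t'(1)] t'(3) by blast
qed

text \<open>The number \<open>N\<close> of rounds may depend on the state, whereas the time bounds
  are to depend on \<open>m\<close> and \<open>n\<close> only; hence the upper estimate
  \<open>M\<close>.\<close>

lemma wp_for_loop:
  assumes "I 0 (set_var v 0 s)"
    and "\<And>i s. i < N \<Longrightarrow> I i s \<Longrightarrow> wp p (\<lambda>s'. I (Suc i) (set_var v (Suc (s' v 0)) s')) T s"
    and "\<And>i s. i \<le> N \<Longrightarrow> I i s \<Longrightarrow> eval_expr e s = N \<and> s v 0 = i"
    and "N \<le> M"
  shows "wp (for_loop v e p) (I N) (M * (T + cost_expr e + 10) + cost_expr e + 7) s"
proof -
  have "wp (While (Sub e (var v)) (Seq p (assign v (Add (var v) (Const 1))))) (I N)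
      ((N - 0) * (T + cost_expr e + 10) + cost_expr e + 4) (set_var v 0 s)"
    by (rule wp_while[where I = I and i = 0, OF _ _ le0 assms(1)]) (fact assms(2,3))+
  moreover have "N * (T + cost_expr e + 10) \<le> M * (T + cost_expr e + 10)"
    using assms(4) by (rule mult_le_mono1)
  ultimately have "wp (While (Sub e (var v)) (Seq p (assign v (Add (var v) (Const 1))))) (I N)
      (M * (T + cost_expr e + 10) + cost_expr e + 4) (set_var v 0 s)"
    using wp_mono[where Q = "I N" and Q' = "I N"] by simp
  then have "wp (for_loop v e p) (I N)
      (max_time (assign v (Const 0)) + (M * (T + cost_expr e + 10) + cost_expr e + 4)) s"
    unfolding for_loop_def by (intro wp_Seq_loop_free) simp_all
  then show ?thesis by (rule wp_mono) auto
qed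

text \<open>Without a multiplication instruction, a factor known when the program is written is
  unfolded into additions. The factors used depend on \<open>m\<close> alone, so the cost is
  constant in \<open>n\<close>.\<close>

fun mult_expr :: "nat \<Rightarrow> expr \<Rightarrow> expr" where
  "mult_expr 0 e = Const 0"
| "mult_expr (Suc k) e = Add (mult_expr k e) e"

lemma eval_mult_expr [simp]: "eval_expr (mult_expr k e) s = k * eval_expr e s"
  by (induction k) auto

definition neq :: "expr \<Rightarrow> expr \<Rightarrow> expr" where
  "neq e e' = Add (Sub e e') (Sub e' e)"

lemma eval_neq [simp]: "eval_expr (neq e e') s = 0 \<longleftrightarrow> eval_expr e s = eval_expr e' s"
  by (auto simp: neq_def)

text \<open>Frame condition of a program that writes only to the banks in \<open>V\<close>.\<close>

definition agree :: "nat set \<Rightarrow> state \<Rightarrow> state \<Rightarrow> bool" where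
  "agree V s s' \<longleftrightarrow> (\<forall>v. v \<notin> V \<longrightarrow> s' v = s v)"


section \<open>The program\<close>

text \<open>
  The weights of the current row are stored in bank \<open>b_row\<close>; except for it and the output bank,
  every bank holds a single scalar variable in its cell 0.
\<close>

abbreviation (input) "b_input \<equiv> 0 :: nat"
abbreviation (input) "b_string \<equiv> 1 :: nat"
abbreviation (input) "b_row \<equiv> 2 :: nat"
abbreviation (input) "b_pos \<equiv> 3 :: nat"
abbreviation (input) "b_symbol \<equiv> 4 :: nat"
abbreviation (input) "b_start \<equiv> 5 :: nat"
abbreviation (input) "b_ext \<equiv> 6 :: nat"
abbreviation (input) "b_index \<equiv> 7 :: nat"
abbreviation (input) "b_power \<equiv> 8 :: nat"
abbreviation (input) "b_prefix \<equiv> 9 :: nat"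
abbreviation (input) "b_old \<equiv> 10 :: nat"
abbreviation (input) "b_near \<equiv> 11 :: nat"
abbreviation (input) "b_far \<equiv> 12 :: nat"
abbreviation (input) "b_nears \<equiv> 13 :: nat"
abbreviation (input) "b_fars \<equiv> 14 :: nat"
abbreviation (input) "b_rep \<equiv> 15 :: nat"
abbreviation (input) "b_bound \<equiv> 16 :: nat"
abbreviation (input) "b_best \<equiv> 17 :: nat"

section \<open>Rows of weights for a fixed window start\<close>

definition init_body :: "nat \<Rightarrow> program" where
  "init_body m = Seq
     (Cond (neq (Read b_string (var b_index)) (Read b_string (var b_start)))
       (Write b_row (var b_index) (Const 0)) (Write b_row (var b_index) (var b_power)))
     (assign b_power (mult_expr (m + 2) (var b_power)))"

definition init_row :: "nat \<Rightarrow> program" where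
  "init_row m = Seq (assign b_power (Const 1)) (for_loop b_index (var b_start) (init_body m))"

definition init_time :: "nat \<Rightarrow> nat \<Rightarrow> nat" where
  "init_time m n = 3 + (n * (max_time (init_body m) + 12) + 9)"

lemma wp_init_row:
  assumes "s b_start 0 = b" "b \<le> n"
  shows "wp (init_row m) (\<lambda>s'. agree {b_row, b_index, b_power} s s' \<and> (\<forall>x<b. s' b_row x = match_weight m (s b_string) b 0 x))
    (init_time m n) s"
proof -
  define I where "I = (\<lambda>i s'. agree {b_row, b_index, b_power} s s' \<and> s' b_index 0 = i \<and> s' b_power 0 = (m + 2) ^ i \<and>
    (\<forall>x<i. s' b_row x = match_weight m (s b_string) b 0 x))"
  have "wp (for_loop b_index (var b_start) (init_body m)) (I b)
      (n * (max_time (init_body m) + cost_expr (var b_start) + 10) + cost_expr (var b_start) + 7)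
      (set_var b_power 1 s)"
  proof (rule wp_for_loop)
    show "I 0 (set_var b_index 0 (set_var b_power 1 s))" by (auto simp: I_def agree_def)
    show "wp (init_body m) (\<lambda>s'. I (Suc i) (set_var b_index (Suc (s' b_index 0)) s'))
        (max_time (init_body m)) s'" if "i < b" "I i s'" for i s'
    proof (rule wp_loop_free)
      have "s' b_start = s b_start" "s' b_string = s b_string" using that(2) by (auto simp: I_def agree_def)
      then show "I (Suc i) (set_var b_index (Suc (exec (init_body m) s' b_index 0)) (exec (init_body m) s'))"
        using that assms by (auto simp: init_body_def I_def agree_def less_Suc_eq)
    qed (simp add: init_body_def)
    show "eval_expr (var b_start) s' = b \<and> s' b_index 0 = i" if "I i s'" for i s'
      using that assms by (simp add: I_def agree_def)
  qed (use assms in auto)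
  then have "wp (init_row m) (I b) (max_time (assign b_power (Const 1)) +
      (n * (max_time (init_body m) + cost_expr (var b_start) + 10) + cost_expr (var b_start) + 7)) s"
    unfolding init_row_def by (intro wp_Seq_loop_free) simp_all
  then show ?thesis by (rule wp_mono) (auto simp: I_def init_time_def)
qed

text \<open>The row is updated in place from left to right. \<open>b_prefix\<close> carries the
  Horner sum over the previous row, so the entry about to be overwritten is saved in
  \<open>b_old\<close>.\<close>

definition update_body :: "nat \<Rightarrow> program" where
  "update_body m = Seq (assign b_old (Read b_row (var b_index))) (Seq
     (Cond (neq (Read b_string (var b_index)) (Read b_string (Add (var b_start) (Add (var b_ext) (Const 1)))))
       (Write b_row (var b_index) (mult_expr m (var b_old)))
       (Write b_row (var b_index) (Add (mult_expr m (var b_old)) (mult_expr (4 * m ^ 2) (var b_prefix)))))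
     (assign b_prefix (Add (mult_expr m (var b_prefix)) (var b_old))))"

definition update_row :: "nat \<Rightarrow> program" where
  "update_row m = Seq (assign b_prefix (Const 0)) (for_loop b_index (var b_start) (update_body m))"

definition update_time :: "nat \<Rightarrow> nat \<Rightarrow> nat" where
  "update_time m n = 3 + (n * (max_time (update_body m) + 12) + 9)"

lemma wp_update_row:
  assumes "s b_start 0 = b" "s b_ext 0 = e" "b \<le> n" "\<And>x. x < b \<Longrightarrow> s b_row x = match_weight m (s b_string) b e x"
  shows "wp (update_row m)
    (\<lambda>s'. agree {b_row, b_index, b_prefix, b_old} s s' \<and> (\<forall>x<b. s' b_row x = match_weight m (s b_string) b (Suc e) x))
    (update_time m n) s"
proof -
  define I where "I = (\<lambda>i s'. agree {b_row, b_index, b_prefix, b_old} s s' \<and> s' b_index 0 = i \<and>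
    s' b_prefix 0 = horner m (match_weight m (s b_string) b e) i \<and>
    (\<forall>x<i. s' b_row x = match_weight m (s b_string) b (Suc e) x) \<and> (\<forall>x. i \<le> x \<and> x < b \<longrightarrow> s' b_row x = match_weight m (s b_string) b e x))"
  have "wp (for_loop b_index (var b_start) (update_body m)) (I b)
      (n * (max_time (update_body m) + cost_expr (var b_start) + 10) + cost_expr (var b_start) + 7)
      (set_var b_prefix 0 s)"
  proof (rule wp_for_loop)
    show "I 0 (set_var b_index 0 (set_var b_prefix 0 s))" using assms(4) by (auto simp: I_def agree_def)
    show "wp (update_body m) (\<lambda>s'. I (Suc i) (set_var b_index (Suc (s' b_index 0)) s'))
        (max_time (update_body m)) s'" if "i < b" "I i s'" for i s'
    proof (rule wp_loop_free)
      have "s' b_start = s b_start" "s' b_string = s b_string" "s' b_ext = s b_ext" using that(2) by (auto simp: I_def agree_def)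
      then show "I (Suc i) (set_var b_index (Suc (exec (update_body m) s' b_index 0)) (exec (update_body m) s'))"
        using that assms by (auto simp: update_body_def I_def agree_def less_Suc_eq)
    qed (simp add: update_body_def)
    show "eval_expr (var b_start) s' = b \<and> s' b_index 0 = i" if "I i s'" for i s'
      using that assms by (simp add: I_def agree_def)
  qed (use assms in auto)
  then have "wp (update_row m) (I b) (max_time (assign b_prefix (Const 0)) +
      (n * (max_time (update_body m) + cost_expr (var b_start) + 10) + cost_expr (var b_start) + 7)) s"
    unfolding update_row_def by (intro wp_Seq_loop_free) simp_all
  then show ?thesis by (rule wp_mono) (auto simp: I_def update_time_def)
qed

definition eval_body :: "nat \<Rightarrow> program" where
  "eval_body m = Seq
     (assign b_near (Add (mult_expr (m + 1) (var b_near)) (Read b_row (var b_index))))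
     (assign b_far (Add (mult_expr (m + 2) (var b_far)) (Read b_row (var b_index))))"

definition eval_row :: "nat \<Rightarrow> program" where
  "eval_row m = Seq (Seq (assign b_near (Const 0)) (assign b_far (Const 0)))
     (for_loop b_index (var b_start) (eval_body m))"

definition eval_time :: "nat \<Rightarrow> nat \<Rightarrow> nat" where
  "eval_time m n = 6 + (n * (max_time (eval_body m) + 12) + 9)"

lemma wp_eval_row:
  assumes "s b_start 0 = b" "b \<le> n"
  shows "wp (eval_row m)
    (\<lambda>s'. agree {b_index, b_near, b_far} s s' \<and>
      s' b_near 0 = horner (m + 1) (s b_row) b \<and> s' b_far 0 = horner (m + 2) (s b_row) b)
    (eval_time m n) s"
proof -
  define I where "I = (\<lambda>i s'. agree {b_index, b_near, b_far} s s' \<and> s' b_index 0 = i \<and>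
    s' b_near 0 = horner (m + 1) (s b_row) i \<and> s' b_far 0 = horner (m + 2) (s b_row) i)"
  have "wp (for_loop b_index (var b_start) (eval_body m)) (I b)
      (n * (max_time (eval_body m) + cost_expr (var b_start) + 10) + cost_expr (var b_start) + 7)
      (set_var b_far 0 (set_var b_near 0 s))"
  proof (rule wp_for_loop)
    show "I 0 (set_var b_index 0 (set_var b_far 0 (set_var b_near 0 s)))" by (auto simp: I_def agree_def)
    show "wp (eval_body m) (\<lambda>s'. I (Suc i) (set_var b_index (Suc (s' b_index 0)) s'))
        (max_time (eval_body m)) s'" if "i < b" "I i s'" for i s'
    proof (rule wp_loop_free)
      have "s' b_row = s b_row" using that(2) by (auto simp: I_def agree_def)
      then show "I (Suc i) (set_var b_index (Suc (exec (eval_body m) s' b_index 0)) (exec (eval_body m) s'))"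
        using that by (auto simp: eval_body_def I_def agree_def)
    qed (simp add: eval_body_def)
    show "eval_expr (var b_start) s' = b \<and> s' b_index 0 = i" if "I i s'" for i s'
      using that assms by (simp add: I_def agree_def)
  qed (use assms in auto)
  then have "wp (eval_row m) (I b)
      (max_time (Seq (assign b_near (Const 0)) (assign b_far (Const 0))) +
      (n * (max_time (eval_body m) + cost_expr (var b_start) + 10) + cost_expr (var b_start) + 7)) s"
    unfolding eval_row_def by (intro wp_Seq_loop_free) simp_all
  then show ?thesis by (rule wp_mono) (auto simp: I_def eval_time_def)
qed

section \<open>Evaluating the potential\<close>

definition block :: "nat \<Rightarrow> program" where
  "block m = Seq (init_row m) (Seq (for_loop b_ext (Sub (var b_pos) (var b_start)) (update_row m))
     (Seq (eval_row m)
       (Seq (assign b_nears (Add (var b_nears) (var b_near)))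
         (assign b_fars (Add (var b_fars) (var b_far))))))"

definition block_time :: "nat \<Rightarrow> nat \<Rightarrow> nat" where
  "block_time m n = init_time m n + ((n * (update_time m n + 15) + 12) + (eval_time m n + 14))"

definition block_banks :: "nat set" where
  "block_banks = {b_row, b_ext, b_index, b_power, b_prefix, b_old, b_near, b_far, b_nears, b_fars}"

lemma wp_block:
  assumes "s b_start 0 = b" "s b_pos 0 = k" "b \<le> k" "k \<le> n"
  shows "wp (block m)
    (\<lambda>s'. agree block_banks s s' \<and>
      s' b_nears 0 = s b_nears 0 + horner (m + 1) (match_weight m (s b_string) b (k - b)) b \<and>
      s' b_fars 0 = s b_fars 0 + horner (m + 2) (match_weight m (s b_string) b (k - b)) b)
    (block_time m n) s"
  unfolding block_def block_time_def
proof (intro wp_Seq)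
  let ?Q = "\<lambda>s'. agree block_banks s s' \<and>
      s' b_nears 0 = s b_nears 0 + horner (m + 1) (match_weight m (s b_string) b (k - b)) b \<and>
      s' b_fars 0 = s b_fars 0 + horner (m + 2) (match_weight m (s b_string) b (k - b)) b"
  let ?last = "Seq (assign b_nears (Add (var b_nears) (var b_near)))
         (assign b_fars (Add (var b_fars) (var b_far)))"
  let ?for = "for_loop b_ext (Sub (var b_pos) (var b_start)) (update_row m)"
  define I where "I = (\<lambda>i s'. agree (block_banks - {b_nears, b_fars}) s s' \<and> s' b_ext 0 = i \<and>
    (\<forall>x<b. s' b_row x = match_weight m (s b_string) b i x))"
  have last: "wp ?last ?Q 14 s3"
    if "agree (block_banks - {b_nears, b_fars}) s s3"
      "s3 b_near 0 = horner (m + 1) (match_weight m (s b_string) b (k - b)) b"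
      "s3 b_far 0 = horner (m + 2) (match_weight m (s b_string) b (k - b)) b" for s3
  proof -
    have "wp ?last ?Q (max_time ?last) s3"
      using that by (intro wp_loop_free) (auto simp: agree_def block_banks_def)
    moreover have "max_time ?last = 14" by simp
    ultimately show ?thesis by (simp only:)
  qed
  have eval: "wp (eval_row m) (wp ?last ?Q 14) (eval_time m n) s2" if "I (k - b) s2" for s2
  proof (rule wp_mono[OF wp_eval_row[of s2 b n m] last])
    fix s3 assume s3: "agree {b_index, b_near, b_far} s2 s3 \<and>
      s3 b_near 0 = horner (m + 1) (s2 b_row) b \<and> s3 b_far 0 = horner (m + 2) (s2 b_row) b"
    have "horner c (s2 b_row) b = horner c (match_weight m (s b_string) b (k - b)) b" for c
      using that by (intro horner_cong) (auto simp: I_def)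
    then show "s3 b_near 0 = horner (m + 1) (match_weight m (s b_string) b (k - b)) b"
      "s3 b_far 0 = horner (m + 2) (match_weight m (s b_string) b (k - b)) b" using s3 by auto
    show "agree (block_banks - {b_nears, b_fars}) s s3"
      using s3 that by (auto simp: agree_def block_banks_def I_def)
  qed (use that assms in \<open>auto simp: I_def agree_def block_banks_def\<close>)
  have loop: "wp ?for (I (k - b)) (n * (update_time m n + 15) + 12) s1"
    if s1: "agree {b_row, b_index, b_power} s s1" "\<forall>x<b. s1 b_row x = match_weight m (s b_string) b 0 x" for s1
  proof -
    have "wp ?for (I (k - b)) (n * (update_time m n + cost_expr (Sub (var b_pos) (var b_start)) + 10)
        + cost_expr (Sub (var b_pos) (var b_start)) + 7) s1"
    proof (rule wp_for_loop)
      show "I 0 (set_var b_ext 0 s1)" using s1 by (auto simp: I_def agree_def block_banks_def)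
      show "wp (update_row m) (\<lambda>s'. I (Suc i) (set_var b_ext (Suc (s' b_ext 0)) s')) (update_time m n) s'"
        if i: "i < k - b" "I i s'" for i s'
      proof -
        have eq: "s' b_start = s b_start" "s' b_string = s b_string" "s' b_ext 0 = i"
          using i(2) by (auto simp: I_def agree_def block_banks_def)
        have "wp (update_row m)
            (\<lambda>s''. agree {b_row, b_index, b_prefix, b_old} s' s'' \<and> (\<forall>x<b. s'' b_row x = match_weight m (s' b_string) b (Suc i) x))
            (update_time m n) s'"
          using i(2) assms eq by (intro wp_update_row) (auto simp: I_def)
        then show ?thesis
          by (rule wp_mono) (use i(2) eq in \<open>auto simp: I_def agree_def block_banks_def\<close>)
      qed
      show "eval_expr (Sub (var b_pos) (var b_start)) s' = k - b \<and> s' b_ext 0 = i" if "I i s'" for i s'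
        using that assms by (simp add: I_def agree_def block_banks_def)
    qed (use assms in auto)
    then show ?thesis by (rule wp_mono) simp_all
  qed
  have init: "wp (init_row m) (\<lambda>s'. agree {b_row, b_index, b_power} s s' \<and> (\<forall>x<b. s' b_row x = match_weight m (s b_string) b 0 x))
    (init_time m n) s"
    using assms by (intro wp_init_row) auto
  show "wp (init_row m) (wp (Seq ?for (Seq (eval_row m) ?last)) ?Q
      (n * (update_time m n + 15) + 12 + (eval_time m n + 14))) (init_time m n) s"
  proof (rule wp_mono[OF init _ order_refl], elim conjE, rule wp_Seq)
    fix s1 assume s1: "agree {b_row, b_index, b_power} s s1" "\<forall>x<b. s1 b_row x = match_weight m (s b_string) b 0 x"
    show "wp ?for (wp (Seq (eval_row m) ?last) ?Q (eval_time m n + 14))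
        (n * (update_time m n + 15) + 12) s1"
      by (rule wp_mono[OF loop[OF s1] _ order_refl], rule wp_Seq, rule eval)
  qed
qed

text \<open>The factor \<open>n\<close> of the near part is an input and no constant of the program,
  so the last loop adds the near sum \<open>n\<close> times. The starts include \<open>b_pos\<close>
  itself, which gives the potential of the prefix of length \<open>Suc k\<close>.\<close>

definition pot_program :: "nat \<Rightarrow> program" where
  "pot_program m = Seq (Seq (assign b_nears (Const 0)) (assign b_fars (Const 0)))
     (Seq (for_loop b_start (Add (var b_pos) (Const 1)) (block m))
       (for_loop b_rep (var b_input) (assign b_fars (Add (var b_fars) (var b_nears)))))"

definition pot_time :: "nat \<Rightarrow> nat \<Rightarrow> nat" where
  "pot_time m n = 6 + ((n * (block_time m n + 14) + 11) + (n * 19 + 9))"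

definition pot_banks :: "nat set" where
  "pot_banks = insert b_start (insert b_rep block_banks)"

lemma wp_pot_program:
  assumes "s b_input 0 = n" "s b_pos 0 = k" "k < n"
  shows "wp (pot_program m)
    (\<lambda>s'. agree pot_banks s s' \<and> s' b_fars 0 = potential m n (s b_string) (Suc k)) (pot_time m n) s"
  unfolding pot_program_def pot_time_def
proof (rule wp_Seq)
  let ?Q = "\<lambda>s'. agree pot_banks s s' \<and> s' b_fars 0 = potential m n (s b_string) (Suc k)"
  let ?near = "\<lambda>b. horner (m + 1) (match_weight m (s b_string) b (k - b)) b"
  let ?far = "\<lambda>b. horner (m + 2) (match_weight m (s b_string) b (k - b)) b"
  let ?add = "assign b_fars (Add (var b_fars) (var b_nears))"
  define I where "I = (\<lambda>i s'. agree pot_banks s s' \<and> s' b_start 0 = i \<and>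
    s' b_nears 0 = sum ?near {..<i} \<and> s' b_fars 0 = sum ?far {..<i})"
  define J where "J = (\<lambda>i s'. agree pot_banks s s' \<and> s' b_rep 0 = i \<and>
    s' b_nears 0 = sum ?near {..<Suc k} \<and>
    s' b_fars 0 = sum ?far {..<Suc k} + i * sum ?near {..<Suc k})"
  have pot_eq: "potential m n (s b_string) (Suc k) = sum ?far {..<Suc k} + n * sum ?near {..<Suc k}"
    by (simp add: potential_def start_potential_def sum.distrib sum_distrib_left distrib_left)
  have add: "wp (for_loop b_rep (var b_input) ?add) ?Q (n * 19 + 9) s1" if "I (Suc k) s1" for s1
  proof -
    have "wp (for_loop b_rep (var b_input) ?add) (J n)
        (n * (max_time ?add + cost_expr (var b_input) + 10) + cost_expr (var b_input) + 7) s1"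
    proof (rule wp_for_loop)
      show "J 0 (set_var b_rep 0 s1)" using that by (auto simp: I_def J_def agree_def pot_banks_def)
      show "wp ?add (\<lambda>s'. J (Suc i) (set_var b_rep (Suc (s' b_rep 0)) s')) (max_time ?add) s'"
        if "J i s'" for i s'
        using that by (intro wp_loop_free) (auto simp: J_def agree_def pot_banks_def block_banks_def)
      show "eval_expr (var b_input) s' = n \<and> s' b_rep 0 = i" if "J i s'" for i s'
        using that assms by (simp add: J_def agree_def pot_banks_def block_banks_def)
    qed simp
    moreover have "?Q s'" if "J n s'" for s'
      using that by (simp only: J_def pot_eq)
    ultimately show ?thesis by (rule wp_mono) simp_all
  qed
  have loop: "wp (for_loop b_start (Add (var b_pos) (Const 1)) (block m)) (I (Suc k))
      (n * (block_time m n + 14) + 11) s1"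
    if s1: "agree {b_nears, b_fars} s s1" "s1 b_nears 0 = 0" "s1 b_fars 0 = 0" for s1
  proof -
    have "wp (for_loop b_start (Add (var b_pos) (Const 1)) (block m)) (I (Suc k))
        (n * (block_time m n + cost_expr (Add (var b_pos) (Const 1)) + 10)
        + cost_expr (Add (var b_pos) (Const 1)) + 7) s1"
    proof (rule wp_for_loop)
      show "I 0 (set_var b_start 0 s1)" using s1 by (auto simp: I_def agree_def pot_banks_def block_banks_def)
      show "wp (block m) (\<lambda>s'. I (Suc i) (set_var b_start (Suc (s' b_start 0)) s')) (block_time m n) s'"
        if i: "i < Suc k" "I i s'" for i s'
      proof -
        have eq: "s' b_pos = s b_pos" "s' b_string = s b_string" "s' b_start 0 = i"
          using i(2) by (auto simp: I_def agree_def pot_banks_def block_banks_def)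
        have "wp (block m) (\<lambda>s''. agree block_banks s' s'' \<and>
            s'' b_nears 0 = s' b_nears 0 + ?near i \<and> s'' b_fars 0 = s' b_fars 0 + ?far i)
            (block_time m n) s'"
          using wp_block[of s' i k n m] i assms eq by simp
        then show ?thesis
          by (rule wp_mono) (use i(2) eq in \<open>auto simp: I_def agree_def pot_banks_def block_banks_def\<close>)
      qed
      show "eval_expr (Add (var b_pos) (Const 1)) s' = Suc k \<and> s' b_start 0 = i" if "I i s'" for i s'
        using that assms by (simp add: I_def agree_def pot_banks_def block_banks_def)
    qed (use assms in auto)
    then show ?thesis by (rule wp_mono) simp_all
  qed
  have "wp (Seq (assign b_nears (Const 0)) (assign b_fars (Const 0)))
      (\<lambda>s'. agree {b_nears, b_fars} s s' \<and> s' b_nears 0 = 0 \<and> s' b_fars 0 = 0)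
      (max_time (Seq (assign b_nears (Const 0)) (assign b_fars (Const 0)))) s"
    by (rule wp_loop_free) (auto simp: agree_def)
  then show "wp (Seq (assign b_nears (Const 0)) (assign b_fars (Const 0)))
     (wp (Seq (for_loop b_start (Add (var b_pos) (Const 1)) (block m)) (for_loop b_rep (var b_input) ?add)) ?Q
       (n * (block_time m n + 14) + 11 + (n * 19 + 9))) 6 s"
  proof (rule wp_mono, elim conjE, intro wp_Seq[of "for_loop _ _ _"])
    fix s1 assume s1: "agree {b_nears, b_fars} s s1" "s1 b_nears 0 = 0" "s1 b_fars 0 = 0"
    show "wp (for_loop b_start (Add (var b_pos) (Const 1)) (block m))
        (wp (for_loop b_rep (var b_input) ?add) ?Q (n * 19 + 9)) (n * (block_time m n + 14) + 11) s1"
      by (rule wp_mono[OF loop[OF s1] _ order_refl], rule add)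
  qed simp
qed

section \<open>The greedy choice of a symbol\<close>

text \<open>With \<open>b_bound\<close> holding the right-hand side of \<open>good\<close>, the
  truncated difference is 0 exactly if the extended prefix is good. A later good symbol replaces an
  earlier one.\<close>

definition candidate :: "nat \<Rightarrow> program" where
  "candidate m = Seq (Write b_string (var b_pos) (var b_symbol)) (Seq (pot_program m)
     (Cond (Sub (mult_expr (4 * (m + 2) ^ 2) (var b_fars)) (var b_bound)) Skip (assign b_best (var b_symbol))))"

definition candidate_time :: "nat \<Rightarrow> nat \<Rightarrow> nat" where
  "candidate_time m n = 5 + (pot_time m n + (cost_expr (mult_expr (4 * (m + 2) ^ 2) (var b_fars)) + 8))"

definition candidate_banks :: "nat set" where
  "candidate_banks = insert b_string (insert b_best pot_banks)"

lemma wp_candidate: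
  assumes "s b_input 0 = n" "s b_pos 0 = k" "s b_symbol 0 = a" "s b_bound 0 = n * (m + 2) ^ Suc k" "k < n"
    and "\<And>i. i < k \<Longrightarrow> s b_string i = S i"
  shows "wp (candidate m)
    (\<lambda>s'. agree candidate_banks s s' \<and> s' b_string = (s b_string)(k := a) \<and>
      s' b_best 0 = (if good m n (S(k := a)) (Suc k) then a else s b_best 0)) (candidate_time m n) s"
  unfolding candidate_def candidate_time_def
proof (rule wp_Seq)
  let ?Q = "\<lambda>s'. agree candidate_banks s s' \<and> s' b_string = (s b_string)(k := a) \<and>
      s' b_best 0 = (if good m n (S(k := a)) (Suc k) then a else s b_best 0)"
  let ?c = "Cond (Sub (mult_expr (4 * (m + 2) ^ 2) (var b_fars)) (var b_bound)) Skip (assign b_best (var b_symbol))"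
  let ?s1 = "s(b_string := (s b_string)(k := a))"
  have banks: "b_input \<notin> pot_banks" "b_string \<notin> pot_banks" "b_pos \<notin> pot_banks" "b_symbol \<notin> pot_banks"
    "b_bound \<notin> pot_banks" "b_best \<notin> pot_banks"
    by (simp_all add: pot_banks_def block_banks_def)
  \<comment> \<open>Cell \<open>k\<close> of the bank may still hold an earlier candidate; agreement
    with \<open>S\<close> below \<open>k\<close> suffices, since cell \<open>k\<close> is
    overwritten.\<close>
  have good: "good m n ((s b_string)(k := a)) (Suc k) \<longleftrightarrow> good m n (S(k := a)) (Suc k)"
    using assms(6) by (intro good_cong) auto
  have "wp (pot_program m)
      (\<lambda>s'. agree pot_banks ?s1 s' \<and> s' b_fars 0 = potential m n (?s1 b_string) (Suc k)) (pot_time m n) ?s1"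
    using assms by (intro wp_pot_program) auto
  then have "wp (pot_program m) (wp ?c ?Q (max_time ?c)) (pot_time m n) ?s1"
  proof (rule wp_mono)
    fix s' assume s': "agree pot_banks ?s1 s' \<and> s' b_fars 0 = potential m n (?s1 b_string) (Suc k)"
    then have eq: "s' b_bound = s b_bound" "s' b_symbol = s b_symbol" "s' b_best = s b_best" "s' b_string = (s b_string)(k := a)"
      using banks by (auto simp: agree_def)
    have "eval_expr (Sub (mult_expr (4 * (m + 2) ^ 2) (var b_fars)) (var b_bound)) s' = 0
        \<longleftrightarrow> good m n (S(k := a)) (Suc k)"
      using s' assms(4) unfolding good[symmetric] by (simp add: good_def eq)
    moreover have "agree candidate_banks s (set_var b_best y s')" "agree candidate_banks s s'" for y
      using s' by (auto simp: agree_def candidate_banks_def)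
    ultimately show "wp ?c ?Q (max_time ?c) s'"
      using assms(3) eq by (intro wp_loop_free) (auto simp del: eval_expr.simps(4))
  qed simp
  then have "wp (Seq (pot_program m) ?c) ?Q (pot_time m n + max_time ?c) ?s1" by (rule wp_Seq)
  moreover have "max_time ?c = cost_expr (mult_expr (4 * (m + 2) ^ 2) (var b_fars)) + 8" by simp
  ultimately have "wp (Seq (pot_program m) ?c) ?Q
      (pot_time m n + (cost_expr (mult_expr (4 * (m + 2) ^ 2) (var b_fars)) + 8)) ?s1"
    by (simp only:)
  then have "wp (Write b_string (var b_pos) (var b_symbol)) (wp (Seq (pot_program m) ?c) ?Q
      (pot_time m n + (cost_expr (mult_expr (4 * (m + 2) ^ 2) (var b_fars)) + 8)))
      (max_time (Write b_string (var b_pos) (var b_symbol))) s"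
    using assms(2,3) by (intro wp_loop_free) auto
  moreover have "max_time (Write b_string (var b_pos) (var b_symbol)) = 5" by simp
  ultimately show "wp (Write b_string (var b_pos) (var b_symbol)) (wp (Seq (pot_program m) ?c) ?Q
      (pot_time m n + (cost_expr (mult_expr (4 * (m + 2) ^ 2) (var b_fars)) + 8))) 5 s"
    by (simp only:)
qed

definition extend :: "nat \<Rightarrow> program" where
  "extend m = Seq (Seq (assign b_bound (mult_expr (m + 2) (var b_bound))) (assign b_best (Const 0)))
     (Seq (for_loop b_symbol (Const (8 * (m + 2) ^ 2)) (candidate m)) (Write b_string (var b_pos) (var b_best)))"

definition extend_time :: "nat \<Rightarrow> nat \<Rightarrow> nat" where
  "extend_time m n = (cost_expr (mult_expr (m + 2) (var b_bound)) + 5) +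
     ((8 * (m + 2) ^ 2 * (candidate_time m n + 11) + 8) + 5)"

definition extend_banks :: "nat set" where
  "extend_banks = insert b_symbol (insert b_bound candidate_banks)"

lemma wp_extend:
  assumes "s b_input 0 = n" "s b_pos 0 = k" "s b_bound 0 = n * (m + 2) ^ k" "k < n" "good m n (s b_string) k"
  shows "wp (extend m)
    (\<lambda>s'. agree extend_banks s s' \<and> s' b_bound 0 = n * (m + 2) ^ Suc k \<and>
      (\<exists>a<8 * (m + 2) ^ 2. s' b_string = (s b_string)(k := a) \<and> good m n (s' b_string) (Suc k))) (extend_time m n) s"
  unfolding extend_def extend_time_def
proof (rule wp_Seq)
  let ?q = "8 * (m + 2) ^ 2"
  let ?Q = "\<lambda>s'. agree extend_banks s s' \<and> s' b_bound 0 = n * (m + 2) ^ Suc k \<and>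
      (\<exists>a<?q. s' b_string = (s b_string)(k := a) \<and> good m n (s' b_string) (Suc k))"
  let ?s1 = "set_var b_best 0 (set_var b_bound ((m + 2) * s b_bound 0) s)"
  define G where "G = (\<lambda>a. good m n ((s b_string)(k := a)) (Suc k))"
  \<comment> \<open>\<open>b_best\<close> keeps the default 0 until a good symbol occurs; after the
    loop \<open>exists_good_symbol\<close> rules out that none occurred.\<close>
  define I where "I = (\<lambda>i s'. agree extend_banks s s' \<and> s' b_symbol 0 = i \<and> s' b_bound 0 = n * (m + 2) ^ Suc k \<and>
    (\<exists>y. s' b_string = (s b_string)(k := y)) \<and>
    (if \<exists>a<i. G a then s' b_best 0 < i \<and> G (s' b_best 0) else s' b_best 0 = 0))"
  have banks: "b_input \<notin> extend_banks" "b_pos \<notin> extend_banks" "b_symbol \<notin> candidate_banks"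
    "b_bound \<notin> candidate_banks" "b_symbol \<in> extend_banks" "b_bound \<in> extend_banks" "b_best \<in> extend_banks"
    "b_string \<in> extend_banks" "candidate_banks \<subseteq> extend_banks"
    by (auto simp: extend_banks_def candidate_banks_def pot_banks_def block_banks_def)
  have "wp (for_loop b_symbol (Const ?q) (candidate m)) (I ?q)
      (?q * (candidate_time m n + cost_expr (Const ?q) + 10) + cost_expr (Const ?q) + 7) ?s1"
  proof (rule wp_for_loop)
    have "(s b_string)(k := s b_string k) = s b_string" by simp
    then show "I 0 (set_var b_symbol 0 ?s1)"
      using assms banks by (auto simp: I_def agree_def algebra_simps intro: exI[of _ "s b_string k"])
    show "wp (candidate m) (\<lambda>s'. I (Suc i) (set_var b_symbol (Suc (s' b_symbol 0)) s')) (candidate_time m n) s'"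
      if inv: "i < ?q" "I i s'" for i s'
    proof -
      obtain y where y: "s' b_string = (s b_string)(k := y)" using inv(2) by (auto simp: I_def)
      have "s' b_input = s b_input" "s' b_pos = s b_pos" using inv(2) banks by (auto simp: I_def agree_def)
      then have "wp (candidate m)
          (\<lambda>s''. agree candidate_banks s' s'' \<and> s'' b_string = (s' b_string)(k := i) \<and>
            s'' b_best 0 = (if good m n ((s b_string)(k := i)) (Suc k) then i else s' b_best 0))
          (candidate_time m n) s'"
        using inv(2) y assms by (intro wp_candidate) (auto simp: I_def)
      then show ?thesis
      proof (rule wp_mono)
        fix s''
        assume s'': "agree candidate_banks s' s'' \<and> s'' b_string = (s' b_string)(k := i) \<and>
            s'' b_best 0 = (if good m n ((s b_string)(k := i)) (Suc k) then i else s' b_best 0)"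
        have "s'' b_symbol = s' b_symbol" "s'' b_bound = s' b_bound" using s'' banks by (auto simp: agree_def)
        moreover have "agree extend_banks s (set_var b_symbol z s'')" for z
          using s'' inv(2) banks by (auto simp: agree_def I_def)
        moreover have "s'' b_string = (s b_string)(k := i)" using s'' y by simp
        moreover have "s'' b_best 0 = (if G i then i else s' b_best 0)" using s'' by (simp add: G_def)
        ultimately show "I (Suc i) (set_var b_symbol (Suc (s'' b_symbol 0)) s'')"
          using inv(2) by (auto simp: I_def less_Suc_eq split: if_splits)
      qed simp
    qed
    show "eval_expr (Const ?q) s' = ?q \<and> s' b_symbol 0 = i" if "I i s'" for i s'
      using that by (simp add: I_def)
  qed simp
  then have loop: "wp (for_loop b_symbol (Const ?q) (candidate m)) (I ?q)
      (?q * (candidate_time m n + 11) + 8) ?s1"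
    by (rule wp_mono) simp_all
  have last: "wp (Write b_string (var b_pos) (var b_best)) ?Q 5 s'" if inv: "I ?q s'" for s'
  proof -
    obtain y where y: "s' b_string = (s b_string)(k := y)" using inv by (auto simp: I_def)
    have "\<exists>a<?q. G a"
      using exists_good_symbol[OF assms(5,4)] by (simp add: G_def)
    then have best: "s' b_best 0 < ?q" "G (s' b_best 0)" using inv unfolding I_def by presburger+
    have "s' b_pos = s b_pos" using inv banks by (auto simp: I_def agree_def)
    then have "wp (Write b_string (var b_pos) (var b_best)) ?Q (max_time (Write b_string (var b_pos) (var b_best))) s'"
      using inv best y banks assms(2) by (intro wp_loop_free) (auto simp: I_def agree_def G_def)
    moreover have "max_time (Write b_string (var b_pos) (var b_best)) = 5" by simp
    ultimately show ?thesis by (simp only:)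
  qed
  let ?p = "Seq (assign b_bound (mult_expr (m + 2) (var b_bound))) (assign b_best (Const 0))"
  let ?rest = "Seq (for_loop b_symbol (Const ?q) (candidate m)) (Write b_string (var b_pos) (var b_best))"
  have "wp ?rest ?Q (?q * (candidate_time m n + 11) + 8 + 5) ?s1"
    by (rule wp_Seq, rule wp_mono[OF loop _ order_refl], rule last)
  then have "wp ?p (wp ?rest ?Q (?q * (candidate_time m n + 11) + 8 + 5)) (max_time ?p) s"
    by (intro wp_loop_free) (auto simp del: mult_expr.simps)
  moreover have "max_time ?p = cost_expr (mult_expr (m + 2) (var b_bound)) + 5" by (simp del: mult_expr.simps)
  ultimately show "wp ?p (wp ?rest ?Q (?q * (candidate_time m n + 11) + 8 + 5))
      (cost_expr (mult_expr (m + 2) (var b_bound)) + 5) s"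
    by (simp only:)
qed

definition greedy_program :: "nat \<Rightarrow> program" where
  "greedy_program m = Seq (assign b_bound (var b_input)) (for_loop b_pos (var b_input) (extend m))"

definition greedy_time :: "nat \<Rightarrow> nat \<Rightarrow> nat" where
  "greedy_time m n = 4 + (n * (extend_time m n + 12) + 9)"

lemma wp_greedy_program:
  "wp (greedy_program m)
    (\<lambda>s'. (\<forall>k\<le>n. good m n (s' b_string) k) \<and> (\<forall>i<n. s' b_string i < 8 * (m + 2) ^ 2))
    (greedy_time m n) (initial_state n)"
  unfolding greedy_program_def greedy_time_def
proof (rule wp_Seq)
  let ?s = "set_var b_bound n (initial_state n)"
  let ?Q = "\<lambda>s'. (\<forall>k\<le>n. good m n (s' b_string) k) \<and> (\<forall>i<n. s' b_string i < 8 * (m + 2) ^ 2)"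
  define I where "I = (\<lambda>k s'. s' b_input 0 = n \<and> s' b_pos 0 = k \<and> s' b_bound 0 = n * (m + 2) ^ k \<and>
    (\<forall>k'\<le>k. good m n (s' b_string) k') \<and> (\<forall>i<k. s' b_string i < 8 * (m + 2) ^ 2))"
  have "wp (for_loop b_pos (var b_input) (extend m)) (I n)
      (n * (extend_time m n + cost_expr (var b_input) + 10) + cost_expr (var b_input) + 7) ?s"
  proof (rule wp_for_loop)
    show "I 0 (set_var b_pos 0 ?s)" by (simp add: I_def initial_state_def good_0)
    show "wp (extend m) (\<lambda>s'. I (Suc k) (set_var b_pos (Suc (s' b_pos 0)) s')) (extend_time m n) s"
      if inv: "k < n" "I k s" for k s
    proof -
      have "wp (extend m)
          (\<lambda>s'. agree extend_banks s s' \<and> s' b_bound 0 = n * (m + 2) ^ Suc k \<and>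
            (\<exists>a<8 * (m + 2) ^ 2. s' b_string = (s b_string)(k := a) \<and> good m n (s' b_string) (Suc k)))
          (extend_time m n) s"
        using inv by (intro wp_extend) (auto simp: I_def)
      then show ?thesis
      proof (rule wp_mono)
        fix s'
        assume s': "agree extend_banks s s' \<and> s' b_bound 0 = n * (m + 2) ^ Suc k \<and>
            (\<exists>a<8 * (m + 2) ^ 2. s' b_string = (s b_string)(k := a) \<and> good m n (s' b_string) (Suc k))"
        then obtain a where a: "a < 8 * (m + 2) ^ 2" "s' b_string = (s b_string)(k := a)"
          "good m n (s' b_string) (Suc k)" by blast
        have "b_input \<notin> extend_banks" "b_pos \<notin> extend_banks"
          by (auto simp: extend_banks_def candidate_banks_def pot_banks_def block_banks_def)
        then have "s' b_input = s b_input" "s' b_pos = s b_pos" using s' by (auto simp: agree_def)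
        \<comment> \<open>Shorter prefixes remain good because only cell \<open>k\<close> differs
          from the string before.\<close>
        moreover have "good m n (s' b_string) k'" if "k' \<le> Suc k" for k'
        proof (cases "k' = Suc k")
          case False
          then have "k' \<le> k" using that by simp
          then show ?thesis using \<open>I k s\<close> good_cong[of k' "s' b_string" "s b_string" m n] a(2)
            by (simp add: I_def)
        qed (use a in simp)
        moreover have "s' b_string i < 8 * (m + 2) ^ 2" if "i < Suc k" for i
          using \<open>I k s\<close> a(1,2) that by (auto simp: I_def less_Suc_eq)
        ultimately show "I (Suc k) (set_var b_pos (Suc (s' b_pos 0)) s')"
          using inv(2) s' by (simp add: I_def)
      qed simp
    qed
    show "eval_expr (var b_input) s' = n \<and> s' b_pos 0 = k" if "I k s'" for k s'
      using that by (simp add: I_def)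
  qed simp
  then have "wp (for_loop b_pos (var b_input) (extend m)) ?Q (n * (extend_time m n + 12) + 9) ?s"
    by (rule wp_mono) (simp_all add: I_def)
  then have "wp (assign b_bound (var b_input)) (wp (for_loop b_pos (var b_input) (extend m)) ?Q
      (n * (extend_time m n + 12) + 9)) (max_time (assign b_bound (var b_input))) (initial_state n)"
    by (intro wp_loop_free) (simp_all add: initial_state_def)
  then show "wp (assign b_bound (var b_input)) (wp (for_loop b_pos (var b_input) (extend m)) ?Q
      (n * (extend_time m n + 12) + 9)) 4 (initial_state n)"
    by (rule wp_mono) auto
qed

section \<open>Polynomial time\<close>

text \<open>Using \<open>Suc n\<close> lets one constant serve all \<open>n\<close>, including
  0.\<close>

definition poly_bounded :: "nat \<Rightarrow> (nat \<Rightarrow> nat) \<Rightarrow> bool" where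
  "poly_bounded d f \<longleftrightarrow> (\<exists>C. \<forall>n. f n \<le> C * Suc n ^ d)"

lemma poly_bounded_const: "poly_bounded d (\<lambda>n. c)"
  unfolding poly_bounded_def by (intro exI[of _ c]) simp

lemma poly_bounded_mono:
  assumes "poly_bounded d f" "d \<le> d'"
  shows "poly_bounded d' f"
proof -
  obtain C where C: "f n \<le> C * Suc n ^ d" for n using assms(1) unfolding poly_bounded_def by blast
  have "f n \<le> C * Suc n ^ d'" for n
  proof -
    have "C * Suc n ^ d \<le> C * Suc n ^ d'"
      using assms(2) by (intro mult_le_mono2 power_increasing) auto
    with C[of n] show ?thesis by (rule order_trans)
  qed
  then show ?thesis unfolding poly_bounded_def by blast
qed

lemma poly_bounded_add:
  assumes "poly_bounded d f" "poly_bounded d g"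
  shows "poly_bounded d (\<lambda>n. f n + g n)"
proof -
  obtain C C' where "f n \<le> C * Suc n ^ d" "g n \<le> C' * Suc n ^ d" for n
    using assms unfolding poly_bounded_def by blast
  then have "f n + g n \<le> (C + C') * Suc n ^ d" for n
    unfolding distrib_right by (intro add_mono)
  then show ?thesis unfolding poly_bounded_def by blast
qed

lemma poly_bounded_mult_const:
  assumes "poly_bounded d f"
  shows "poly_bounded d (\<lambda>n. c * f n)"
proof -
  obtain C where "f n \<le> C * Suc n ^ d" for n using assms unfolding poly_bounded_def by blast
  then have "c * f n \<le> (c * C) * Suc n ^ d" for n unfolding mult.assoc by (intro mult_le_mono2)
  then show ?thesis unfolding poly_bounded_def by blast
qed

lemma poly_bounded_mult_id:
  assumes "poly_bounded d f"
  shows "poly_bounded (Suc d) (\<lambda>n. n * f n)"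
proof -
  obtain C where C: "f n \<le> C * Suc n ^ d" for n using assms unfolding poly_bounded_def by blast
  have "n * f n \<le> C * Suc n ^ Suc d" for n
    using mult_le_mono[OF le_SucI[OF order_refl] C[of n], of n] by (simp add: mult_ac)
  then show ?thesis unfolding poly_bounded_def by blast
qed

text \<open>Four nested loops have at most \<open>n\<close> rounds each: over the position, the
  window start, the extension to the right and the left index. The loop over the symbols has a
  number of rounds that depends on \<open>m\<close> only.\<close>

lemma poly_bounded_greedy_time: "poly_bounded 4 (greedy_time m)"
proof -
  note intros = poly_bounded_add poly_bounded_const poly_bounded_mult_const
  have row: "poly_bounded (Suc 0) (init_time m)" "poly_bounded (Suc 0) (update_time m)"
    "poly_bounded (Suc 0) (eval_time m)"
    unfolding init_time_def[abs_def] update_time_def[abs_def] eval_time_def[abs_def]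
    by (intro intros poly_bounded_mult_id)+
  have "poly_bounded (Suc (Suc 0)) (block_time m)"
    unfolding block_time_def[abs_def]
    by (intro intros poly_bounded_mult_id poly_bounded_mono[OF row(1), of "Suc (Suc 0)"]
        poly_bounded_mono[OF row(3), of "Suc (Suc 0)"] row(2)) auto
  then have "poly_bounded (Suc (Suc (Suc 0))) (pot_time m)"
    unfolding pot_time_def[abs_def] by (intro intros poly_bounded_mult_id)
  then have "poly_bounded (Suc (Suc (Suc 0))) (extend_time m)"
    unfolding extend_time_def[abs_def] candidate_time_def by (intro intros)
  then have "poly_bounded (Suc (Suc (Suc (Suc 0)))) (greedy_time m)"
    unfolding greedy_time_def[abs_def] by (intro intros poly_bounded_mult_id)
  then show ?thesis by (simp add: eval_nat_numeral)
qed

lemma poly_bounded_bigo: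
  assumes "poly_bounded d g" "\<And>n. f n \<le> g n"
  shows "(\<lambda>n. real (f n)) \<in> O(\<lambda>n. real n ^ d)"
proof -
  obtain C where C: "g n \<le> C * Suc n ^ d" for n using assms(1) unfolding poly_bounded_def by blast
  have "norm (real (f n)) \<le> real (C * 2 ^ d) * norm (real n ^ d)" if "n \<ge> 1" for n
  proof -
    have "f n \<le> C * Suc n ^ d" using assms(2) C le_trans by blast
    also have "\<dots> \<le> C * (2 * n) ^ d" using that by (intro mult_le_mono2 power_mono) auto
    also have "\<dots> = (C * 2 ^ d) * n ^ d" by (simp add: power_mult_distrib)
    finally have "real (f n) \<le> real ((C * 2 ^ d) * n ^ d)" by (rule of_nat_mono)
    then show ?thesis by simp
  qed
  then show ?thesis
    by (intro bigoI[where c = "real (C * 2 ^ d)"] eventually_sequentiallyI[of 1]) auto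
qed

theorem theorem4p5:
  "\<exists>(k::nat) (C::real) (A::real). \<forall>\<epsilon>::real. 0 < \<epsilon> \<and> \<epsilon> < 1 \<longrightarrow>
     (\<exists>(c::real) (q::nat) (p::program) (time::nat \<Rightarrow> nat).
        0 < c \<and> c \<le> C / \<epsilon> \<and>
        real q \<le> A / \<epsilon> ^ 4 \<and>
        (\<lambda>n. real (time n)) \<in> O(\<lambda>n. real n ^ k) \<and>
        (\<forall>n. \<exists>S. computes_string p n (time n) S \<and>
           length S = n \<and> set S \<subseteq> {..<q} \<and>
           long_distance_sync_string c \<epsilon> S))"
proof (rule exI[of _ "4::nat"], rule exI[of _ "2::real"], rule exI[of _ "968::real"], intro allI impI)
  fix \<epsilon> :: real
  assume \<epsilon>: "0 < \<epsilon> \<and> \<epsilon> < 1"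
  \<comment> \<open>\<open>m\<close> depends on \<open>\<epsilon>\<close> alone, so one program
    serves all \<open>n\<close>, and only constant factors of its running time vary with
    \<open>\<epsilon>\<close>.\<close>
  define m where "m = nat \<lceil>8 / \<epsilon>\<rceil>"
  let ?q = "8 * (m + 2) ^ 2"
  have m: "8 / \<epsilon> \<le> real m" by (simp add: m_def of_nat_ceiling)
  have "0 < 8 / \<epsilon>" using \<epsilon> by simp
  then have "real m \<le> 8 / \<epsilon> + 1" unfolding m_def by linarith
  moreover have "1 \<le> 1 / \<epsilon>" using \<epsilon> by (simp add: field_simps)
  \<comment> \<open>Since \<open>1 <= 1 / \<epsilon>\<close>, the summand \<open>1 + 2\<close> is at
    most \<open>3 / \<epsilon>\<close>. Squaring gives \<open>8 * 11 ^ 2 = 968\<close>.\<close>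
  ultimately have "real m + 2 \<le> 11 / \<epsilon>" by simp
  then have "(real m + 2) ^ 2 \<le> (11 / \<epsilon>) ^ 2" by (intro power_mono) auto
  then have "real ?q \<le> 968 / \<epsilon> ^ 2" by (simp add: power_divide add.commute)
  \<comment> \<open>The alphabet has size of order \<open>1 / \<epsilon> ^ 2\<close>, which is
    weakened to the stated power using \<open>\<epsilon> < 1\<close>.\<close>
  also have "\<dots> \<le> 968 / \<epsilon> ^ 4"
    using \<epsilon> by (intro divide_left_mono power_decreasing mult_pos_pos) auto
  finally have q: "real ?q \<le> 968 / \<epsilon> ^ 4" .
  have "\<exists>t s. runs (greedy_program m) (initial_state n) t s \<and> t \<le> greedy_time m n \<and>
      (\<forall>k\<le>n. good m n (s 1) k) \<and> (\<forall>i<n. s 1 i < ?q)" for n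
    using wp_greedy_program[of m n] unfolding wp_def by blast
  then obtain time final where run: "runs (greedy_program m) (initial_state n) (time n) (final n)"
    "time n \<le> greedy_time m n" "\<And>k. k \<le> n \<Longrightarrow> good m n (final n 1) k"
    "\<And>i. i < n \<Longrightarrow> final n 1 i < ?q" for n
    by metis
  show "\<exists>c q p time. 0 < c \<and> c \<le> 2 / \<epsilon> \<and> real q \<le> 968 / \<epsilon> ^ 4 \<and>
      (\<lambda>n. real (time n)) \<in> O(\<lambda>n. real n ^ 4) \<and>
      (\<forall>n. \<exists>S. computes_string p n (time n) S \<and> length S = n \<and> set S \<subseteq> {..<q} \<and>
        long_distance_sync_string c \<epsilon> S)"
  proof (intro exI conjI allI)
    show "0 < 2 / \<epsilon>" using \<epsilon> by simp
    show "real ?q \<le> 968 / \<epsilon> ^ 4" by (rule q)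
    show "(\<lambda>n. real (time n)) \<in> O(\<lambda>n. real n ^ 4)"
      by (rule poly_bounded_bigo[OF poly_bounded_greedy_time run(2)])
    fix n
    show "computes_string (greedy_program m) n (time n) (map (final n 1) [0..<n])"
      unfolding computes_string_def using run(1) by blast
    show "set (map (final n 1) [0..<n]) \<subseteq> {..<?q}" using run(4)[of _ n] by auto
    show "long_distance_sync_string (2 / \<epsilon>) \<epsilon> (map (final n 1) [0..<n])"
      using \<epsilon> m run(3)[of _ n] by (intro long_distance_sync_string_if_good) auto
  qed auto
qed

end
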